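(* Let $a$ and $b$ be odd integers with $a>0$, $b>-a$ and $\gcd(a,b)=1$. Then any integer $n$ with $$\frac n3>66a^2(9a-1)+a+(33a-1)b+(2a(18a-1)+b)\sqrt{15(2a(9a-1)+b)}$$ can be written as $$3\,\frac{w(aw+b)}2+\frac{x(ax+b)}2+\frac{y(ay+b)}2+\frac{z(az+b)}2$$ with $w,x,y,z\in\mathbb{N}$.
   Context: $\mathbb{N}=\{0,1,2,\ldots\}$. *)

theory Defs
  imports Complex_Main
begin

end

theory Submission
  imports Defs "HOL-Number_Theory.Number_Theory" "HOL-Computational_Algebra.Squarefree"
begin

text \<open>
  A solution amounts to \<open>3w\<^sup>2 + x\<^sup>2 + y\<^sup>2 + z\<^sup>2 = A\<close> and \<open>3w + x + y + z = B\<close> for some \<open>A, B\<close> with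
  \<open>2n = aA + bB\<close>. Cauchy's method produces it from a representation
  \<open>6A - B\<^sup>2 = X\<^sup>2 + Y\<^sup>2 + 3Z\<^sup>2\<close>; nonnegativity holds as soon as \<open>5A < B\<^sup>2 + 2B + 6\<close>. The bound on \<open>n\<close> says
  that the admissible interval for \<open>B\<close> is longer than \<open>18a\<close>, so it contains 18 consecutive members of
  the residue class modulo \<open>a\<close> that makes \<open>A\<close> integral, and among these some \<open>B\<close> makes \<open>6A - B\<^sup>2\<close>
  (or \<open>(6A - B\<^sup>2)/9\<close>, if \<open>3\<close> divides \<open>a\<close> and \<open>n\<close>) congruent to 5 modulo 12.

  That \<open>x\<^sup>2 + y\<^sup>2 + 3z\<^sup>2\<close> represents every positive \<open>N\<close> congruent to 5 modulo 12 follows, for squarefree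
  \<open>N\<close>, by constructing a positive definite ternary form of determinant 3 in the same genus that takes
  the value \<open>N\<close>, and reducing it. The construction needs a \<open>q\<close> with \<open>-q\<close> a square modulo \<open>N\<close> and \<open>-3N\<close>
  a square modulo \<open>q\<close>. Instead of a prime \<open>q\<close> (from Dirichlet's theorem) a product of primes suffices, and
  its existence follows from a statement about two quadratic characters that has a short elementary proof.
\<close>

section \<open>Quadratic characters\<close>

text \<open>A real Dirichlet character modulo \<open>M\<close>, taken on natural numbers. The
  principal character is included; nontriviality is always stated through a witness with value
  -1.\<close>

definition quadratic_character :: "nat \<Rightarrow> (nat \<Rightarrow> int) \<Rightarrow> bool" where
  "quadratic_character M \<psi> \<longleftrightarrow> M > 0 \<and> (\<forall>m n. \<psi> (m * n) = \<psi> m * \<psi> n) \<and>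
     (\<forall>n. \<psi> (n mod M) = \<psi> n) \<and>
     (\<forall>n. if coprime n M then \<psi> n = 1 \<or> \<psi> n = -1 else \<psi> n = 0)"

lemma quadratic_characterD:
  assumes "quadratic_character M \<psi>"
  shows "M > 0" "\<psi> (m * n) = \<psi> m * \<psi> n" "\<psi> (n mod M) = \<psi> n"
    "coprime n M \<Longrightarrow> \<psi> n = 1 \<or> \<psi> n = -1" "\<not> coprime n M \<Longrightarrow> \<psi> n = 0"
    "\<psi> 1 = 1" "\<psi> (m ^ k) = \<psi> m ^ k" "\<bar>\<psi> n\<bar> \<le> 1"
proof -
  show 1: "M > 0" "\<And>m n. \<psi> (m * n) = \<psi> m * \<psi> n" "\<psi> (n mod M) = \<psi> n"
    "\<And>n. coprime n M \<Longrightarrow> \<psi> n = 1 \<or> \<psi> n = -1" "\<And>n. \<not> coprime n M \<Longrightarrow> \<psi> n = 0"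
    using assms unfolding quadratic_character_def by meson+
  show 2: "\<psi> 1 = 1" using 1(2)[of 1 1] 1(4)[of 1] by auto
  show "\<psi> (m ^ k) = \<psi> m ^ k" using 1 2 by (induction k) auto
  show "\<bar>\<psi> n\<bar> \<le> 1" using 1(4,5)[of n] by (cases "coprime n M") auto
qed

text \<open>Multiplication by \<open>g\<close> permutes the residues modulo \<open>M\<close> and
  changes the sign of every value, so the sum equals its own negative.\<close>

lemma quadratic_character_sum_period:
  assumes \<psi>: "quadratic_character M \<psi>" and g: "\<psi> g = -1"
  shows "(\<Sum>n<M. \<psi> n) = 0"
proof -
  note D = quadratic_characterD[OF \<psi>]
  have cop: "coprime g M" using D(5)[of g] g by fastforce
  have "inj_on (\<lambda>n. g * n mod M) {..<M}"
  proof (rule inj_onI)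
    fix x y assume *: "x \<in> {..<M}" "y \<in> {..<M}" "g * x mod M = g * y mod M"
    then have "[g * x = g * y] (mod M)" by (simp add: cong_def)
    then have "[x = y] (mod M)" using cop by (simp add: cong_mult_lcancel_nat)
    then show "x = y" using * by (simp add: cong_def)
  qed
  moreover have "(\<lambda>n. g * n mod M) ` {..<M} \<subseteq> {..<M}" using D(1) by auto
  ultimately have "bij_betw (\<lambda>n. g * n mod M) {..<M} {..<M}"
    unfolding bij_betw_def by (simp add: endo_inj_surj)
  then have "(\<Sum>n<M. \<psi> n) = (\<Sum>n<M. \<psi> (g * n mod M))"
    by (rule sum.reindex_bij_betw[symmetric])
  also have "\<dots> = (\<Sum>n<M. - \<psi> n)" by (simp add: D(2,3) g)
  finally show ?thesis by (simp add: sum_negf)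
qed

text \<open>Full periods cancel, and fewer than \<open>M\<close> terms of size at most 1
  remain.\<close>

lemma quadratic_character_sum_le:
  assumes \<psi>: "quadratic_character M \<psi>" and g: "\<psi> g = -1"
  shows "\<bar>\<Sum>n<k. \<psi> n\<bar> \<le> int M"
proof (induction k rule: less_induct)
  case (less k)
  note D = quadratic_characterD[OF \<psi>]
  show ?case
  proof (cases "k < M")
    case True
    have "\<bar>\<Sum>n<k. \<psi> n\<bar> \<le> (\<Sum>n<k. \<bar>\<psi> n\<bar>)" by (rule sum_abs)
    also have "\<dots> \<le> (\<Sum>n<k. 1)" by (rule sum_mono) (rule D(8))
    finally show ?thesis using True by simp
  next
    case False
    then have k: "k = M + (k - M)" by simp
    have "(\<Sum>n<M + j. \<psi> n) = (\<Sum>n<M. \<psi> n) + (\<Sum>n<j. \<psi> n)" for j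
    proof (induction j)
      case (Suc j)
      have "\<psi> (M + j) = \<psi> j" using D(3)[of "M + j"] D(3)[of j] by simp
      then show ?case using Suc by simp
    qed simp
    then have "(\<Sum>n<k. \<psi> n) = (\<Sum>n<k - M. \<psi> n)"
      using k quadratic_character_sum_period[OF \<psi> g] by (metis add_0)
    moreover have "k - M < k" using False D(1) by simp
    ultimately show ?thesis using less.IH by simp
  qed
qed

section \<open>Partial summation and tails of character series\<close>

lemma abel_sum_bound:
  fixes f g :: "nat \<Rightarrow> real"
  assumes A: "\<And>k. \<bar>\<Sum>n\<in>{a<..k}. f n\<bar> \<le> K"
    and g: "\<And>n. n > a \<Longrightarrow> g (Suc n) \<le> g n" "\<And>n. n > a \<Longrightarrow> 0 \<le> g n"
  shows "\<bar>\<Sum>n\<in>{a<..b}. f n * g n\<bar> \<le> K * g (Suc a)"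
proof (cases "b \<le> a")
  case True
  have "0 \<le> K" using A[of a] by simp
  then show ?thesis using True g(2)[of "Suc a"] by simp
next
  case False
  have K: "0 \<le> K" using A[of a] by simp
  have ins: "{a<..Suc k} = insert (Suc k) {a<..k}" if "k \<ge> a" for k using that by auto
  have "Suc a \<le> b" using False by simp
  \<comment> \<open>With the boundary term of partial summation subtracted, each induction step adds
    only a partial sum of \<open>f\<close> times \<open>g k - g (Suc k)\<close>, and these bounds
    telescope.\<close>
  then have "\<bar>(\<Sum>n\<in>{a<..b}. f n * g n) - (\<Sum>n\<in>{a<..b}. f n) * g b\<bar> \<le> K * (g (Suc a) - g b)"
  proof (induction b rule: dec_induct)
    case base
    show ?case using ins[of a] by simp
  next
    case (step k)
    have "(\<Sum>n\<in>{a<..Suc k}. f n * g n) - (\<Sum>n\<in>{a<..Suc k}. f n) * g (Suc k)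
      = ((\<Sum>n\<in>{a<..k}. f n * g n) - (\<Sum>n\<in>{a<..k}. f n) * g k) + (\<Sum>n\<in>{a<..k}. f n) * (g k - g (Suc k))"
      using step by (simp add: ins algebra_simps)
    moreover have "\<bar>(\<Sum>n\<in>{a<..k}. f n) * (g k - g (Suc k))\<bar> \<le> K * (g k - g (Suc k))"
      unfolding abs_mult using step g(1)[of k] A[of k] by (intro mult_mono) auto
    ultimately show ?case using step by (simp add: algebra_simps abs_le_iff)
  qed
  moreover have "\<bar>(\<Sum>n\<in>{a<..b}. f n) * g b\<bar> \<le> K * g b"
    unfolding abs_mult using False g(2)[of b] A[of b] K by (intro mult_mono) auto
  ultimately show ?thesis unfolding right_diff_distrib by linarith
qed

text \<open>A sum over \<open>{a<..k}\<close> is a difference of two initial sums, hence at most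
  \<open>2 * M\<close> in size; the decreasing weights then contribute only their first
  value.\<close>

lemma quadratic_character_tail:
  assumes \<psi>: "quadratic_character M \<psi>" and g: "\<psi> g = -1"
  shows "\<bar>\<Sum>n\<in>{a<..b}. real_of_int (\<psi> n) / sqrt n\<bar> \<le> 2 * real M / sqrt (Suc a)"
proof -
  have "\<bar>\<Sum>n\<in>{a<..k}. real_of_int (\<psi> n)\<bar> \<le> 2 * real M" for k
  proof (cases "a \<le> k")
    case True
    have "{..<Suc k} = {..<Suc a} \<union> {a<..k}" "{..<Suc a} \<inter> {a<..k} = {}" using True by auto
    then have "(\<Sum>n<Suc k. \<psi> n) = (\<Sum>n<Suc a. \<psi> n) + (\<Sum>n\<in>{a<..k}. \<psi> n)"
      by (metis finite_greaterThanAtMost finite_lessThan sum.union_disjoint)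
    then have "\<bar>\<Sum>n\<in>{a<..k}. \<psi> n\<bar> \<le> 2 * int M"
      using quadratic_character_sum_le[OF assms, of "Suc k"] quadratic_character_sum_le[OF assms, of "Suc a"]
      by linarith
    then have "real_of_int \<bar>\<Sum>n\<in>{a<..k}. \<psi> n\<bar> \<le> 2 * real M" by linarith
    then show ?thesis by simp
  qed simp
  then have "\<bar>\<Sum>n\<in>{a<..b}. real_of_int (\<psi> n) * (1 / sqrt n)\<bar> \<le> 2 * real M * (1 / sqrt (Suc a))"
    by (rule abel_sum_bound) (auto intro!: divide_left_mono)
  then show ?thesis by simp
qed

lemma sum_inverse_sqrt_le: "(\<Sum>d\<in>{0<..y}. 1 / sqrt (real d)) \<le> 2 * sqrt y"
proof (induction y)
  case (Suc y)
  have ins: "{0<..Suc y} = insert (Suc y) {0<..y}" by auto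
  have "1 / sqrt (Suc y) \<le> 2 * (sqrt (Suc y) - sqrt y)"
  proof -
    have "(sqrt (Suc y) - sqrt y) * (sqrt (Suc y) + sqrt y) = 1"
      by (simp add: algebra_simps)
    moreover have "sqrt (Suc y) + sqrt y \<le> 2 * sqrt (Suc y)" by simp
    moreover have "sqrt (Suc y) - sqrt y \<ge> 0" by simp
    ultimately have "1 \<le> (sqrt (Suc y) - sqrt y) * (2 * sqrt (Suc y))"
      by (metis mult_left_mono)
    then have "1 \<le> 2 * (sqrt (Suc y) - sqrt y) * sqrt (Suc y)" by (simp only: mult_ac)
    then show ?thesis by (subst pos_divide_le_eq) simp_all
  qed
  then show ?case using Suc ins by simp
qed simp

section \<open>Dirichlet convolution of two characters\<close>

definition char_conv :: "(nat \<Rightarrow> int) \<Rightarrow> (nat \<Rightarrow> int) \<Rightarrow> nat \<Rightarrow> int" where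
  "char_conv \<psi> \<chi> n = (\<Sum>d | d dvd n. \<psi> d * \<chi> (n div d))"

text \<open>Each divisor of \<open>a * b\<close> is a unique product of a divisor of
  \<open>a\<close> and a divisor of \<open>b\<close>; the two factors are recovered as gcds with
  \<open>a\<close> and \<open>b\<close>.\<close>

lemma char_conv_mult:
  assumes \<psi>: "quadratic_character M \<psi>" and \<chi>: "quadratic_character M \<chi>"
    and ab: "coprime a b" "a > 0" "b > 0"
  shows "char_conv \<psi> \<chi> (a * b) = char_conv \<psi> \<chi> a * char_conv \<psi> \<chi> b"
proof -
  note D = quadratic_characterD[OF \<psi>] and E = quadratic_characterD[OF \<chi>]
  have gcds: "gcd (c * d) a = c \<and> gcd (c * d) b = d" if cd: "c dvd a" "d dvd b" for c d
  proof -
    have "coprime a d" "coprime b c" using ab(1) cd by (meson coprime_commute coprime_divisors dvd_refl)+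
    then have "gcd (c * d) a = gcd c a" "gcd (c * d) b = gcd d b"
      by (simp_all only: gcd_mult_left_right_cancel gcd_mult_left_left_cancel)
    then show ?thesis using cd by (simp add: gcd_nat.absorb1)
  qed
  have "char_conv \<psi> \<chi> a * char_conv \<psi> \<chi> b
    = (\<Sum>(c,d)\<in>{c. c dvd a}\<times>{d. d dvd b}. (\<psi> c * \<chi> (a div c)) * (\<psi> d * \<chi> (b div d)))"
    unfolding char_conv_def by (simp add: sum_product sum.cartesian_product)
  also have "\<dots> = (\<Sum>d | d dvd a * b. \<psi> d * \<chi> (a * b div d))"
  proof (rule sum.reindex_bij_witness[where i = "\<lambda>d. (gcd d a, gcd d b)" and j = "\<lambda>(c,d). c * d"], goal_cases)
    case (1 p)
    then show ?case using gcds by auto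
  next
    case (2 p)
    then show ?case by (auto intro: mult_dvd_mono)
  next
    case (3 d)
    then obtain c e where "d = c * e" "c dvd a" "e dvd b" using division_decomp[of d a b] by auto
    then show ?case using gcds by simp
  next
    case (4 d)
    then show ?case by auto
  next
    case (5 p)
    obtain c d where p: "p = (c,d)" by force
    with 5 have "c dvd a" "d dvd b" by auto
    then have "a * b div (c * d) = (a div c) * (b div d)" by (simp add: div_mult_div_if_dvd)
    then show ?case using p by (simp add: D(2) E(2))
  qed
  finally show ?thesis unfolding char_conv_def by simp
qed

text \<open>The value is the sum of \<open>\<psi> p ^ i * \<chi> p ^ (k - i)\<close>: it is
  \<open>k + 1\<close> if both characters are 1 at \<open>p\<close>, an alternating sum equal to 0
  or 1 if the signs differ, and made of nonnegative terms if both vanish. Only the excluded case of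
  two values -1 could be negative.\<close>

lemma char_conv_prime_power:
  assumes \<psi>: "quadratic_character M \<psi>" and \<chi>: "quadratic_character M \<chi>"
    and p: "prime p" "\<not> (\<psi> p = -1 \<and> \<chi> p = -1)"
  shows "char_conv \<psi> \<chi> (p ^ k) \<ge> 0"
    and "even k \<Longrightarrow> coprime p M \<Longrightarrow> char_conv \<psi> \<chi> (p ^ k) \<ge> 1"
proof -
  note D = quadratic_characterD[OF \<psi>] and E = quadratic_characterD[OF \<chi>]
  have "{d. d dvd p ^ k} = (\<lambda>i. p ^ i) ` {..k}"
    using divides_primepow_nat[OF p(1)] by auto
  moreover have "inj_on (\<lambda>i. p ^ i) {..k}" using prime_gt_1_nat[OF p(1)] by (simp add: inj_on_def)
  ultimately have "char_conv \<psi> \<chi> (p ^ k) = (\<Sum>i\<le>k. \<psi> (p ^ i) * \<chi> (p ^ k div p ^ i))"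
    unfolding char_conv_def by (simp add: sum.reindex)
  also have "\<dots> = (\<Sum>i\<le>k. \<psi> p ^ i * \<chi> p ^ (k - i))"
    using prime_gt_0_nat[OF p(1)] by (intro sum.cong) (auto simp: D(7) E(7) power_diff[symmetric])
  finally have eq: "char_conv \<psi> \<chi> (p ^ k) = (\<Sum>i\<le>k. \<psi> p ^ i * \<chi> p ^ (k - i))" .
  have alt: "(\<Sum>i\<le>k. (-1::int) ^ i) = (if even k then 1 else 0)" for k by (induction k) auto
  have alt': "(\<Sum>i\<le>k. (-1::int) ^ (k - i)) = (if even k then 1 else 0)" for k
    using sum.atLeastAtMost_rev[of "\<lambda>i. (-1::int) ^ i" 0 k] alt[of k] by (simp add: atMost_atLeast0)
  show "char_conv \<psi> \<chi> (p ^ k) \<ge> 0"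
  proof (cases "coprime p M")
    case True
    then show ?thesis using D(4)[OF True] E(4)[OF True] p(2) unfolding eq by (auto simp: alt alt')
  next
    case False
    have "0 \<le> (0::int) ^ i * 0 ^ (k - i)" for i by simp
    then show ?thesis unfolding eq D(5)[OF False] E(5)[OF False] by (intro sum_nonneg) blast
  qed
  show "char_conv \<psi> \<chi> (p ^ k) \<ge> 1" if "even k" "coprime p M"
    using D(4)[OF that(2)] E(4)[OF that(2)] p(2) that(1) unfolding eq by (auto simp: alt alt')
qed

text \<open>Multiplicativity allows prime powers to be split off one at a time. In a square every
  exponent is even, so every factor is at least 1.\<close>

lemma char_conv_nonneg:
  assumes \<psi>: "quadratic_character M \<psi>" and \<chi>: "quadratic_character M \<chi>"
    and np: "\<And>p. prime p \<Longrightarrow> \<not> (\<psi> p = -1 \<and> \<chi> p = -1)"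
  shows "n > 0 \<Longrightarrow> char_conv \<psi> \<chi> n \<ge> 0"
    and "m > 0 \<Longrightarrow> coprime m M \<Longrightarrow> char_conv \<psi> \<chi> (m\<^sup>2) \<ge> 1"
proof -
  note D = quadratic_characterD[OF \<psi>] and E = quadratic_characterD[OF \<chi>]
  have one: "char_conv \<psi> \<chi> 1 = 1" unfolding char_conv_def by (simp add: D(6)[simplified] E(6)[simplified])
  have dec: "\<exists>p k n'. prime p \<and> n = p ^ k * n' \<and> \<not> p dvd n' \<and> n' < n \<and> n' > 0"
    if n: "n > 1" for n :: nat
  proof -
    obtain p where p: "prime p" "p dvd n" using prime_factor_nat[of n] n by auto
    obtain n' where n': "n = p ^ multiplicity p n * n'" "\<not> p dvd n'"
      using multiplicity_decompose'[of n p] n p(1) by (metis not_prime_unit not_one_less_zero)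
    have "multiplicity p n > 0" using p n by (simp add: prime_multiplicity_gt_zero_iff)
    then have "p ^ multiplicity p n > 1" using one_less_power[OF prime_gt_1_nat[OF p(1)]] by blast
    moreover have "n' > 0" using n' n by (cases n') auto
    ultimately have "n' < n" using n'(1) by (metis mult.commute n_less_m_mult_n mult.right_neutral nat_mult_less_cancel1)
    then show ?thesis using p(1) n' \<open>n' > 0\<close> by blast
  qed
  show "char_conv \<psi> \<chi> n \<ge> 0" if "n > 0" using that
  proof (induction n rule: less_induct)
    case (less n)
    show ?case
    proof (cases "n = 1")
      case True then show ?thesis using one by simp
    next
      case False
      then obtain p k n' where n': "prime p" "n = p ^ k * n'" "\<not> p dvd n'" "n' < n" "n' > 0"
        using dec[of n] less.prems by (metis nat_neq_iff less_one not_less_zero)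
      have "coprime (p ^ k) n'" using n'(1,3) by (simp add: prime_imp_coprime)
      then have "char_conv \<psi> \<chi> n = char_conv \<psi> \<chi> (p ^ k) * char_conv \<psi> \<chi> n'"
        unfolding n'(2) using n' by (intro char_conv_mult[OF \<psi> \<chi>]) (auto simp: prime_gt_0_nat)
      then show ?thesis using less.IH[OF n'(4,5)] char_conv_prime_power(1)[OF \<psi> \<chi> n'(1) np[OF n'(1)]] by simp
    qed
  qed
  show "char_conv \<psi> \<chi> (m\<^sup>2) \<ge> 1" if "m > 0" "coprime m M" using that
  proof (induction m rule: less_induct)
    case (less n)
    show ?case
    proof (cases "n = 1")
      case True then show ?thesis using one by simp
    next
      case False
      then obtain p k n' where n': "prime p" "n = p ^ k * n'" "\<not> p dvd n'" "n' < n" "n' > 0"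
        using dec[of n] less.prems by (metis nat_neq_iff less_one not_less_zero)
      have "k > 0" using n' by (cases k) auto
      then have cp: "coprime p M" "coprime n' M" using less.prems(2) n'(2) by auto
      have "coprime (p ^ (2*k)) (n'\<^sup>2)" using n'(1,3) by (simp add: prime_imp_coprime)
      moreover have "n\<^sup>2 = p ^ (2*k) * n'\<^sup>2" unfolding n'(2) by (simp add: power_mult_distrib power_mult mult.commute)
      ultimately have "char_conv \<psi> \<chi> (n\<^sup>2) = char_conv \<psi> \<chi> (p ^ (2*k)) * char_conv \<psi> \<chi> (n'\<^sup>2)"
        using n' by (simp add: char_conv_mult[OF \<psi> \<chi>] prime_gt_0_nat)
      moreover have "char_conv \<psi> \<chi> (n'\<^sup>2) \<ge> 1" using less.IH n' cp by simp
      moreover have "char_conv \<psi> \<chi> (p ^ (2*k)) \<ge> 1"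
        using char_conv_prime_power(2)[OF \<psi> \<chi> n'(1) np[OF n'(1)], of "2*k"] cp by simp
      ultimately show ?thesis using mult_mono[of 1 "char_conv \<psi> \<chi> (p ^ (2*k))" 1 "char_conv \<psi> \<chi> (n'\<^sup>2)"] by simp
    qed
  qed
qed

text \<open>Dirichlet's hyperbola method. What matters is that the bound is independent of
  \<open>y\<close>: both series of weighted character values have bounded partial sums and tails of
  order \<open>1 / sqrt y\<close>.\<close>

lemma char_conv_hyperbola:
  fixes y :: nat
  assumes \<psi>: "quadratic_character M \<psi>" and \<chi>: "quadratic_character M \<chi>"
    and g: "\<psi> g = -1" and h: "\<chi> h = -1"
  shows "(\<Sum>n\<in>{0<..y\<^sup>2}. real_of_int (char_conv \<psi> \<chi> n) / sqrt n) \<le> (2 * real M)\<^sup>2 + 8 * real M"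
proof -
  define F where "F d = real_of_int (\<psi> d) / sqrt d" for d
  define G where "G e = real_of_int (\<chi> e) / sqrt e" for e
  define K where "K = 2 * real M"
  have K: "K \<ge> 0" unfolding K_def by simp
  have tF: "\<bar>\<Sum>n\<in>{a<..b}. F n\<bar> \<le> K / sqrt (Suc a)" for a b
    unfolding F_def K_def by (rule quadratic_character_tail[OF \<psi> g])
  have tG: "\<bar>\<Sum>n\<in>{a<..b}. G n\<bar> \<le> K / sqrt (Suc a)" for a b
    unfolding G_def K_def by (rule quadratic_character_tail[OF \<chi> h])
  have F1: "\<bar>F d\<bar> \<le> 1 / sqrt d" for d
    using quadratic_characterD(8)[OF \<psi>, of d] unfolding F_def by (simp add: divide_right_mono abs_le_iff)
  have G1: "\<bar>G d\<bar> \<le> 1 / sqrt d" for d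
    using quadratic_characterD(8)[OF \<chi>, of d] unfolding G_def by (simp add: divide_right_mono abs_le_iff)
  \<comment> \<open>A tail beyond \<open>y\<close> is at most \<open>K / sqrt (y + 1)\<close>, while
    the weights \<open>1 / sqrt d\<close> up to \<open>y\<close> add up to at most
    \<open>2 * sqrt y\<close>; the two square roots cancel.\<close>
  have cross: "\<bar>\<Sum>d\<in>{0<..y}. u d * v d\<bar> \<le> 2 * K"
    if u: "\<And>d. \<bar>u d\<bar> \<le> 1 / sqrt (real d)" and v: "\<And>d. \<bar>v d\<bar> \<le> K / sqrt (Suc y)" for u v :: "nat \<Rightarrow> real"
  proof -
    have "\<bar>\<Sum>d\<in>{0<..y}. u d * v d\<bar> \<le> (\<Sum>d\<in>{0<..y}. \<bar>u d * v d\<bar>)" by (rule sum_abs)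
    also have "\<dots> \<le> (\<Sum>d\<in>{0<..y}. 1 / sqrt (real d) * (K / sqrt (Suc y)))"
      unfolding abs_mult by (intro sum_mono mult_mono u v) auto
    also have "\<dots> = (\<Sum>d\<in>{0<..y}. 1 / sqrt (real d)) * (K / sqrt (Suc y))"
      by (rule sum_distrib_right[symmetric])
    also have "\<dots> \<le> (2 * sqrt y) * (K / sqrt (Suc y))"
      using K by (intro mult_right_mono sum_inverse_sqrt_le) auto
    also have "\<dots> = 2 * K * (sqrt y / sqrt (Suc y))" by simp
    also have "\<dots> \<le> 2 * K * 1" using K by (intro mult_left_mono) auto
    finally show ?thesis by simp
  qed
  define T where "T = {(d,e). d > 0 \<and> e > 0 \<and> d * e \<le> y\<^sup>2}"
  \<comment> \<open>The region \<open>d * e \<le> y\<^sup>2\<close> is cut at \<open>y\<close>: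
    \<open>T1\<close> has \<open>d \<le> y\<close>, and \<open>T2\<close> has \<open>d > y\<close>,
    which forces \<open>e \<le> y\<close>. Thus every long inner sum splits off a tail starting
    beyond \<open>y\<close>.\<close>
  define T1 where "T1 = Sigma {0<..y} (\<lambda>d. {0<..y\<^sup>2 div d})"
  define T2 where "T2 = (\<lambda>(e,d). (d,e)) ` Sigma {0<..y} (\<lambda>e. {y<..y\<^sup>2 div e})"
  have T: "T = T1 \<union> T2"
  proof (intro equalityI subsetI)
    fix p assume "p \<in> T"
    then obtain d e where p: "p = (d,e)" "d > 0" "e > 0" "d * e \<le> y\<^sup>2" unfolding T_def by auto
    show "p \<in> T1 \<union> T2"
    proof (cases "d \<le> y")
      case True
      then show ?thesis using p unfolding T1_def by (simp add: less_eq_div_iff_mult_less_eq mult.commute)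
    next
      case False
      have "e \<le> y"
      proof (rule ccontr)
        assume "\<not> e \<le> y"
        then have "y * y < d * e" using False by (intro mult_strict_mono) auto
        then show False using p by (simp add: power2_eq_square)
      qed
      then have "(e,d) \<in> Sigma {0<..y} (\<lambda>e. {y<..y\<^sup>2 div e})"
        using p False by (simp add: less_eq_div_iff_mult_less_eq mult.commute)
      then show ?thesis using p unfolding T2_def by force
    qed
  next
    fix p assume "p \<in> T1 \<union> T2"
    then show "p \<in> T" unfolding T1_def T2_def T_def
      by (auto simp: less_eq_div_iff_mult_less_eq mult.commute)
  qed
  have disj: "T1 \<inter> T2 = {}" unfolding T1_def T2_def by auto
  have fin: "finite T1" "finite T2" unfolding T1_def T2_def by auto
  have s1: "(\<Sum>(d,e)\<in>T1. F d * G e) = (\<Sum>d\<in>{0<..y}. F d) * (\<Sum>e\<in>{0<..y}. G e)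
      + (\<Sum>d\<in>{0<..y}. F d * (\<Sum>e\<in>{y<..y\<^sup>2 div d}. G e))"
  proof -
    have "(\<Sum>e\<in>{0<..y\<^sup>2 div d}. G e) = (\<Sum>e\<in>{0<..y}. G e) + (\<Sum>e\<in>{y<..y\<^sup>2 div d}. G e)"
      if "d \<in> {0<..y}" for d
    proof -
      have "y \<le> y\<^sup>2 div d" using that by (simp add: less_eq_div_iff_mult_less_eq power2_eq_square)
      then have "{0<..y\<^sup>2 div d} = {0<..y} \<union> {y<..y\<^sup>2 div d}" by auto
      then show ?thesis by (simp add: sum.union_disjoint)
    qed
    then have "(\<Sum>(d,e)\<in>T1. F d * G e) = (\<Sum>d\<in>{0<..y}. F d * ((\<Sum>e\<in>{0<..y}. G e) + (\<Sum>e\<in>{y<..y\<^sup>2 div d}. G e)))"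
      unfolding T1_def by (simp add: sum.Sigma[symmetric] sum_distrib_left[symmetric])
    then show ?thesis by (simp add: distrib_left sum.distrib sum_distrib_right)
  qed
  have s2: "(\<Sum>(d,e)\<in>T2. F d * G e) = (\<Sum>e\<in>{0<..y}. G e * (\<Sum>d\<in>{y<..y\<^sup>2 div e}. F d))"
  proof -
    have "inj_on (\<lambda>(e,d). (d,e)) (Sigma {0<..y} (\<lambda>e. {y<..y\<^sup>2 div e}))" by (auto simp: inj_on_def)
    then have "(\<Sum>(d,e)\<in>T2. F d * G e) = (\<Sum>(e,d)\<in>Sigma {0<..y} (\<lambda>e. {y<..y\<^sup>2 div e}). G e * F d)"
      unfolding T2_def by (subst sum.reindex) (auto intro!: sum.cong)
    then show ?thesis by (simp add: sum.Sigma[symmetric] sum_distrib_left[symmetric])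
  qed
  have "(\<Sum>n\<in>{0<..y\<^sup>2}. real_of_int (char_conv \<psi> \<chi> n) / sqrt n)
      = (\<Sum>n\<in>{0<..y\<^sup>2}. \<Sum>d | d dvd n. F d * G (n div d))"
  proof (rule sum.cong[OF refl])
    fix n assume n: "n \<in> {0<..y\<^sup>2}"
    have "F d * G (n div d) = real_of_int (\<psi> d * \<chi> (n div d)) / sqrt n" if "d dvd n" for d
    proof -
      have "sqrt (real d) * sqrt (real (n div d)) = sqrt (real n)"
        using that by (metis dvd_mult_div_cancel of_nat_mult real_sqrt_mult)
      then show ?thesis unfolding F_def G_def by (simp add: times_divide_times_eq)
    qed
    then show "real_of_int (char_conv \<psi> \<chi> n) / sqrt n = (\<Sum>d | d dvd n. F d * G (n div d))"
      unfolding char_conv_def by (simp add: sum_divide_distrib)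
  qed
  also have "\<dots> = (\<Sum>(n,d)\<in>Sigma {0<..y\<^sup>2} (\<lambda>n. {d. d dvd n}). F d * G (n div d))"
    by (rule sum.Sigma) auto
  also have "\<dots> = (\<Sum>(d,e)\<in>T. F d * G e)"
    by (rule sum.reindex_bij_witness[where i = "\<lambda>(d,e). (d*e, d)" and j = "\<lambda>(n,d). (d, n div d)"])
      (auto simp: T_def div_greater_zero_iff dvd_imp_le intro: dvd_pos_nat)
  also have "\<dots> = (\<Sum>(d,e)\<in>T1. F d * G e) + (\<Sum>(d,e)\<in>T2. F d * G e)"
    unfolding T by (rule sum.union_disjoint[OF fin disj])
  also have "\<dots> \<le> K * K + 2 * K + 2 * K"
  proof -
    have "\<bar>(\<Sum>d\<in>{0<..y}. F d) * (\<Sum>e\<in>{0<..y}. G e)\<bar> \<le> K * K"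
      unfolding abs_mult using tF[of 0 y] tG[of 0 y] K by (intro mult_mono) auto
    moreover have "\<bar>\<Sum>d\<in>{0<..y}. F d * (\<Sum>e\<in>{y<..y\<^sup>2 div d}. G e)\<bar> \<le> 2 * K"
      by (rule cross[OF F1 tG])
    moreover have "\<bar>\<Sum>e\<in>{0<..y}. G e * (\<Sum>d\<in>{y<..y\<^sup>2 div e}. F d)\<bar> \<le> 2 * K"
      by (rule cross[OF G1 tF])
    ultimately show ?thesis unfolding s1 s2 by linarith
  qed
  finally show ?thesis unfolding K_def by (simp add: power2_eq_square)
qed

section \<open>A prime at which two nontrivial characters are both -1\<close>

lemma ln_le_harmonic_sum: "ln (real (Suc k)) \<le> (\<Sum>j\<in>{0<..k}. 1 / real j)"
proof (induction k)
  case (Suc k)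
  have ins: "{0<..Suc k} = insert (Suc k) {0<..k}" by auto
  have "ln (real (Suc (Suc k)) / real (Suc k)) \<le> real (Suc (Suc k)) / real (Suc k) - 1"
    by (rule ln_le_minus_one) simp
  also have "\<dots> = 1 / real (Suc k)" by (simp add: field_simps)
  finally have "ln (real (Suc (Suc k))) - ln (real (Suc k)) \<le> 1 / real (Suc k)"
    by (simp add: ln_div)
  then show ?case using Suc unfolding ins by simp
qed simp

text \<open>Otherwise \<open>\<psi> * \<chi>\<close> would be nonnegative and at least 1 on squares, so that its sum with
  weights \<open>n\<^sup>-\<^sup>1\<^sup>/\<^sup>2\<close> would dominate a harmonic series.\<close>

theorem exists_prime_both_minus_one:
  assumes \<psi>: "quadratic_character M \<psi>" and \<chi>: "quadratic_character M \<chi>"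
    and g: "\<psi> g = -1" and h: "\<chi> h = -1"
  shows "\<exists>p. prime p \<and> \<psi> p = -1 \<and> \<chi> p = -1"
proof (rule ccontr)
  assume "\<not> ?thesis"
  then have np: "\<And>p. prime p \<Longrightarrow> \<not> (\<psi> p = -1 \<and> \<chi> p = -1)" by blast
  note nonneg = char_conv_nonneg[OF \<psi> \<chi> np]
  have M: "M > 0" using quadratic_characterD(1)[OF \<psi>] .
  define B where "B = (2 * real M)\<^sup>2 + 8 * real M"
  have "ln (real (Suc k)) \<le> (1 + real M) * B" for k
  proof -
    define y where "y = 1 + k * M"
    \<comment> \<open>The numbers \<open>1 + j * M\<close> are coprime to \<open>M\<close>, so the
      convolution is at least 1 at their squares, which all lie below \<open>y\<^sup>2\<close>.
      Since \<open>1 + j * M \<le> j * (1 + M)\<close>, their reciprocals dominate a multiple of the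
      harmonic series.\<close>
    define S where "S = (\<lambda>j. 1 + j * M) ` {0<..k}"
    have inj: "inj_on (\<lambda>j. 1 + j * M) {0<..k}" using M by (auto simp: inj_on_def)
    have cop: "coprime (1 + j * M) M" for j
      using gcd_add_mult[of M j 1] by (simp only: coprime_iff_gcd_eq_1 gcd.commute[of _ M] add.commute[of 1]) simp
    have "ln (real (Suc k)) \<le> (\<Sum>j\<in>{0<..k}. 1 / real j)" by (rule ln_le_harmonic_sum)
    also have "\<dots> \<le> (\<Sum>j\<in>{0<..k}. (1 + real M) * (1 / real (1 + j * M)))"
    proof (rule sum_mono)
      fix j assume "j \<in> {0<..k}"
      then show "1 / real j \<le> (1 + real M) * (1 / real (1 + j * M))"
        by (simp add: field_simps add_pos_nonneg)
    qed
    also have "\<dots> = (1 + real M) * (\<Sum>m\<in>S. 1 / real m)"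
      unfolding S_def sum.reindex[OF inj] by (simp add: sum_distrib_left)
    also have "(\<Sum>m\<in>S. 1 / real m) \<le> (\<Sum>m\<in>S. real_of_int (char_conv \<psi> \<chi> (m\<^sup>2)) / sqrt (real (m\<^sup>2)))"
    proof (rule sum_mono)
      fix m assume "m \<in> S"
      then have "m > 0" "coprime m M" using cop unfolding S_def by auto
      then have "char_conv \<psi> \<chi> (m\<^sup>2) \<ge> 1" by (rule nonneg(2)[rotated])
      then show "1 / real m \<le> real_of_int (char_conv \<psi> \<chi> (m\<^sup>2)) / sqrt (real (m\<^sup>2))"
        by (simp add: divide_right_mono)
    qed
    also have "\<dots> = (\<Sum>n\<in>(\<lambda>m. m\<^sup>2) ` S. real_of_int (char_conv \<psi> \<chi> n) / sqrt n)"
      by (subst sum.reindex) (auto simp: inj_on_def)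
    also have "\<dots> \<le> (\<Sum>n\<in>{0<..y\<^sup>2}. real_of_int (char_conv \<psi> \<chi> n) / sqrt n)"
    proof (rule sum_mono2)
      show "(\<lambda>m. m\<^sup>2) ` S \<subseteq> {0<..y\<^sup>2}" unfolding S_def y_def by (auto intro!: power_mono)
      show "0 \<le> real_of_int (char_conv \<psi> \<chi> n) / sqrt n" if "n \<in> {0<..y\<^sup>2} - (\<lambda>m. m\<^sup>2) ` S" for n
        using that nonneg(1)[of n] by simp
    qed simp
    also have "\<dots> \<le> B" unfolding B_def by (rule char_conv_hyperbola[OF assms])
    finally show ?thesis by (simp add: mult_left_mono)
  qed
  from this[of "nat \<lceil>exp ((1 + real M) * B)\<rceil>"] have "real (Suc (nat \<lceil>exp ((1 + real M) * B)\<rceil>)) \<le> exp ((1 + real M) * B)"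
    by (metis exp_le_cancel_iff exp_ln of_nat_0_less_iff zero_less_Suc)
  then show False by linarith
qed

section \<open>Numbers with split prime divisors in a given class modulo squares\<close>

lemma exists_cong_inverse:
  fixes x M :: nat
  assumes "coprime x M"
  obtains u where "[x * u = 1] (mod M)" "coprime u M"
proof -
  obtain u where u: "[x * u = Suc 0] (mod M)" using cong_solve_coprime_nat[OF assms] by blast
  then have "\<exists>w. [u * w = Suc 0] (mod M)" by (auto simp: mult.commute intro: exI[of _ x])
  then have "coprime u M" by (simp only: coprime_iff_invertible_nat)
  then show ?thesis using u that by simp
qed

text \<open>If \<open>g\<close> were not in the group generated modulo \<open>M\<close> by squares and primes with \<open>\<chi> = 1\<close>, a maximal
  group containing the latter but not \<open>g\<close> would have index 2 and define a character \<open>\<psi>\<close> to which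
  the previous theorem applies together with \<open>\<psi>\<chi>\<close>.\<close>

theorem exists_split_representative:
  assumes \<chi>: "quadratic_character M \<chi>" and M: "M > 1" and g: "\<chi> g = 1"
  shows "\<exists>q s. q > 0 \<and> coprime s M \<and> [q = g * s\<^sup>2] (mod M) \<and> (\<forall>p. prime p \<longrightarrow> p dvd q \<longrightarrow> \<chi> p = 1)"
proof (rule ccontr)
  assume neg: "\<not> ?thesis"
  note D = quadratic_characterD[OF \<chi>]
  define R where "R = {x. x < M \<and> coprime x M}"
  \<comment> \<open>Closure under products and the presence of all squares already give a subgroup
    of the units: 1 is a square, and the inverse of \<open>x\<close> is \<open>x\<close> times the
    square of that inverse.\<close>
  define group where "group H \<longleftrightarrow> H \<subseteq> R \<and> (\<forall>x\<in>H. \<forall>y\<in>H. x * y mod M \<in> H) \<and> (\<forall>x\<in>R. x\<^sup>2 mod M \<in> H)" for H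
  define split where "split q \<longleftrightarrow> q > 0 \<and> (\<forall>p. prime p \<longrightarrow> p dvd q \<longrightarrow> \<chi> p = 1)" for q
  have cg: "coprime g M" using D(5)[of g] g by fastforce
  define g' where "g' = g mod M"
  have g': "g' \<in> R" unfolding g'_def R_def using cg M by simp
  have Rmult: "x * y mod M \<in> R" if "x \<in> R" "y \<in> R" for x y
    using that M unfolding R_def by simp
  have split_cop: "coprime q M" if "split q" for q
  proof (rule ccontr)
    assume "\<not> coprime q M"
    then have "gcd q M \<noteq> 1" using coprime_iff_gcd_eq_1 by blast
    then obtain p where p: "prime p" "p dvd gcd q M" using prime_factor_nat by blast
    then have "\<chi> p = 1" using that unfolding split_def by auto
    moreover have "\<not> coprime p M" using p by (auto simp: coprime_absorb_left)
    ultimately have "\<chi> p = 1" "\<not> coprime p M" by auto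
    then show False using D(5) by fastforce
  qed
  \<comment> \<open>The unit classes that agree, up to a square, with a number all of whose prime
    divisors have \<open>\<chi> = 1\<close>. The negated claim says that \<open>g'\<close> is not
    among them.\<close>
  define H0 where "H0 = {x\<in>R. \<exists>q s. split q \<and> coprime s M \<and> [q = x * s\<^sup>2] (mod M)}"
  have split1: "split 1" unfolding split_def by auto
  have split_mult: "split (a * b)" if "split a" "split b" for a b
    using that unfolding split_def by (auto simp: prime_dvd_mult_iff)
  have "group H0" unfolding group_def
  proof (intro conjI ballI)
    show "H0 \<subseteq> R" unfolding H0_def by blast
  next
    fix x y assume "x \<in> H0" "y \<in> H0"
    then obtain q s r t where *: "x \<in> R" "y \<in> R" "split q" "coprime s M" "[q = x * s\<^sup>2] (mod M)"
      "split r" "coprime t M" "[r = y * t\<^sup>2] (mod M)" unfolding H0_def by blast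
    have "[q * r = (x * s\<^sup>2) * (y * t\<^sup>2)] (mod M)" using * cong_mult by blast
    also have "(x * s\<^sup>2) * (y * t\<^sup>2) = (x * y) * (s * t)\<^sup>2" by (simp add: power_mult_distrib)
    also have "[(x * y) * (s * t)\<^sup>2 = (x * y mod M) * (s * t)\<^sup>2] (mod M)"
      by (intro cong_mult) (auto simp: cong_def)
    finally have "[q * r = (x * y mod M) * (s * t)\<^sup>2] (mod M)" .
    moreover have "split (q * r)" "coprime (s * t) M" "x * y mod M \<in> R"
      using * Rmult split_mult by auto
    ultimately show "x * y mod M \<in> H0" unfolding H0_def by blast
  next
    fix x assume x: "x \<in> R"
    then have "coprime x M" unfolding R_def by blast
    then obtain u where u: "[x * u = 1] (mod M)" and cu: "coprime u M" by (rule exists_cong_inverse)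
    have "[(x\<^sup>2 mod M) * u\<^sup>2 = x\<^sup>2 * u\<^sup>2] (mod M)" by (intro cong_mult) (auto simp: cong_def)
    also have "x\<^sup>2 * u\<^sup>2 = (x * u)\<^sup>2" by (simp add: power_mult_distrib)
    also have "[(x * u)\<^sup>2 = 1\<^sup>2] (mod M)" using u by (rule cong_pow)
    finally have "[1 = (x\<^sup>2 mod M) * u\<^sup>2] (mod M)" by (simp add: cong_sym_eq)
    then show "x\<^sup>2 mod M \<in> H0" using Rmult[OF x x] split1 cu unfolding H0_def power2_eq_square by blast
  qed
  moreover have "g' \<notin> H0"
  proof
    assume "g' \<in> H0"
    then obtain q s where *: "split q" "coprime s M" "[q = g' * s\<^sup>2] (mod M)" unfolding H0_def by blast
    have "[g' * s\<^sup>2 = g * s\<^sup>2] (mod M)" unfolding g'_def by (intro cong_mult) (auto simp: cong_def)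
    then show False using neg * cong_trans unfolding split_def by blast
  qed
  ultimately have H0: "H0 \<in> {H. group H \<and> H0 \<subseteq> H \<and> g' \<notin> H}" by blast
  have "finite R" unfolding R_def by simp
  then have "finite {H. group H \<and> H0 \<subseteq> H \<and> g' \<notin> H}"
    by (rule finite_subset[rotated, OF finite_Pow_iff[THEN iffD2]]) (auto simp: group_def)
  from finite_has_maximal[OF this] H0 obtain H where
    Hmem: "H \<in> {H. group H \<and> H0 \<subseteq> H \<and> g' \<notin> H}" and
    Hmax: "\<forall>H'\<in>{H. group H \<and> H0 \<subseteq> H \<and> g' \<notin> H}. H \<le> H' \<longrightarrow> H = H'" by blast
  have H: "group H" "H0 \<subseteq> H" "g' \<notin> H" using Hmem by auto
  have max: "H = H'" if "group H'" "H0 \<subseteq> H'" "g' \<notin> H'" "H \<subseteq> H'" for H'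
    using Hmax that by auto
  have HR: "H \<subseteq> R" and Hm: "\<And>x y. x \<in> H \<Longrightarrow> y \<in> H \<Longrightarrow> x * y mod M \<in> H"
    and Hs: "\<And>x. x \<in> R \<Longrightarrow> x\<^sup>2 mod M \<in> H" using H(1) unfolding group_def by auto
  have H1: "1 \<in> H" using Hs[of 1] M unfolding R_def by simp
  \<comment> \<open>With \<open>u\<close> inverse to \<open>x\<close>, the element \<open>z\<close>
    is the product of \<open>x\<close>, \<open>x * z\<close> and the square of \<open>u\<close>, all
    in \<open>H\<close>.\<close>
  have cancel: "z \<in> H" if "x \<in> H" "z \<in> R" "x * z mod M \<in> H" for x z
  proof -
    have "coprime x M" using that(1) HR unfolding R_def by auto
    then obtain u where u: "[x * u = 1] (mod M)" and cu: "coprime u M" by (rule exists_cong_inverse)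
    have uR: "u mod M \<in> R" using cu M unfolding R_def by simp
    have "(x * (x * z mod M) mod M) * ((u mod M)\<^sup>2 mod M) mod M \<in> H"
      using Hm Hs[OF uR] that by blast
    also have "(x * (x * z mod M) mod M) * ((u mod M)\<^sup>2 mod M) mod M = (x * u)\<^sup>2 * z mod M"
    proof -
      have "(x * (x * z mod M) mod M) * ((u mod M)\<^sup>2 mod M) mod M = (x * (x * z)) * u\<^sup>2 mod M"
        by (simp add: mod_simps)
      then show ?thesis by (simp add: power2_eq_square mult_ac)
    qed
    also have "\<dots> = z"
    proof -
      have "[(x * u)\<^sup>2 * z = 1\<^sup>2 * z] (mod M)" using u by (intro cong_mult cong_pow) auto
      then show ?thesis using that(2) unfolding R_def cong_def by simp
    qed
    finally show ?thesis .
  qed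
  \<comment> \<open>As \<open>x\<^sup>2\<close> lies in \<open>H\<close>, the union of
    \<open>H\<close> and its coset by \<open>x\<close> is again a group; by maximality it contains
    \<open>g'\<close>, which must then lie in the coset.\<close>
  have coset: "\<exists>h\<in>H. g' = h * x mod M" if x: "x \<in> R" "x \<notin> H" for x
  proof (rule ccontr)
    assume no: "\<not> ?thesis"
    define H' where "H' = H \<union> (\<lambda>h. h * x mod M) ` H"
    have xx: "(h * x mod M) * (k * x mod M) mod M = (h * k mod M) * (x\<^sup>2 mod M) mod M" for h k
      unfolding mod_mult_eq by (simp add: power2_eq_square mult_ac)
    have hx: "h * (k * x mod M) mod M = (h * k mod M) * x mod M"
      "(k * x mod M) * h mod M = (h * k mod M) * x mod M" for h k
      unfolding mod_mult_left_eq mod_mult_right_eq by (simp_all add: mult_ac)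
    have "group H'" unfolding group_def
    proof (intro conjI ballI)
      show "H' \<subseteq> R" unfolding H'_def using HR Rmult x by blast
      show "a * b mod M \<in> H'" if ab: "a \<in> H'" "b \<in> H'" for a b
      proof -
        consider "a \<in> H" "b \<in> H"
          | h where "h \<in> H" "a \<in> H" "b = h * x mod M"
          | h where "h \<in> H" "a = h * x mod M" "b \<in> H"
          | h k where "h \<in> H" "k \<in> H" "a = h * x mod M" "b = k * x mod M"
          using ab unfolding H'_def by blast
        then show ?thesis
        proof cases
          case 1
          then show ?thesis unfolding H'_def using Hm by blast
        next
          case 2
          then show ?thesis unfolding H'_def \<open>b = _\<close> hx using Hm by blast
        next
          case 3
          then show ?thesis unfolding H'_def \<open>a = _\<close> hx using Hm by blast
        next
          case 4
          then show ?thesis unfolding H'_def \<open>a = _\<close> \<open>b = _\<close> xx using Hm Hs[OF x(1)] by blast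
        qed
      qed
      show "a\<^sup>2 mod M \<in> H'" if "a \<in> R" for a using Hs[OF that] unfolding H'_def by blast
    qed
    moreover have "g' \<notin> H'" using no H(3) unfolding H'_def by blast
    moreover have "x \<in> H'" unfolding H'_def using H1 x(1) unfolding R_def by force
    ultimately show False using max[of H'] H(2) x(2) unfolding H'_def by blast
  qed
  define \<psi> :: "nat \<Rightarrow> int" where
    "\<psi> n = (if coprime n M then if n mod M \<in> H then 1 else -1 else 0)" for n
  \<comment> \<open>This is the index 2 property. For \<open>x\<close> and \<open>y\<close> outside
    \<open>H\<close>, \<open>g'\<close> lies in both cosets, so \<open>g'\<^sup>2\<close> is
    \<open>x * y\<close> times an element of \<open>H\<close>, and squares belong to
    \<open>H\<close>.\<close>
  have mixed: "x * y mod M \<in> H \<longleftrightarrow> (x \<in> H \<longleftrightarrow> y \<in> H)" if xyR: "x \<in> R" "y \<in> R" for x y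
  proof (cases "x \<in> H"; cases "y \<in> H")
    assume xy: "x \<notin> H" "y \<notin> H"
    obtain h where h: "h \<in> H" "g' = h * x mod M" using coset[OF xyR(1) xy(1)] by blast
    obtain k where k: "k \<in> H" "g' = k * y mod M" using coset[OF xyR(2) xy(2)] by blast
    have "(h * k mod M) * (x * y mod M) mod M = (h * x mod M) * (k * y mod M) mod M"
      unfolding mod_mult_eq by (simp add: mult_ac)
    also have "\<dots> = g'\<^sup>2 mod M" by (simp only: h(2)[symmetric] k(2)[symmetric] power2_eq_square)
    finally have "(h * k mod M) * (x * y mod M) mod M \<in> H" using Hs[OF g'] by simp
    then have "x * y mod M \<in> H" using cancel[OF Hm[OF h(1) k(1)] Rmult[OF xyR]] by blast
    then show ?thesis using xy by simp
  next
    assume "x \<in> H" "y \<in> H"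
    then show ?thesis using Hm by blast
  next
    assume xy: "x \<in> H" "y \<notin> H"
    then have "x * y mod M \<notin> H" using cancel[of x y] xyR by blast
    then show ?thesis using xy by simp
  next
    assume xy: "x \<notin> H" "y \<in> H"
    then have "y * x mod M \<notin> H" using cancel[of y x] xyR by blast
    then show ?thesis using xy by (simp add: mult.commute)
  qed
  have \<psi>: "quadratic_character M \<psi>" unfolding quadratic_character_def
  proof (intro conjI allI)
    show "\<psi> (m * n) = \<psi> m * \<psi> n" for m n
    proof (cases "coprime m M \<and> coprime n M")
      case True
      then have "m mod M \<in> R" "n mod M \<in> R" using M unfolding R_def by auto
      from mixed[OF this] True show ?thesis unfolding \<psi>_def mod_mult_eq by auto
    next
      case False then show ?thesis unfolding \<psi>_def by auto
    qed
  qed (use M in \<open>auto simp: \<psi>_def\<close>)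
  have \<psi>g: "\<psi> g = -1" using H(3) cg unfolding \<psi>_def g'_def by simp
  have \<psi>\<chi>: "quadratic_character M (\<lambda>n. \<psi> n * \<chi> n)"
    unfolding quadratic_character_def
  proof (intro conjI allI)
    note E = quadratic_characterD[OF \<psi>]
    show "\<psi> (m * n) * \<chi> (m * n) = (\<psi> m * \<chi> m) * (\<psi> n * \<chi> n)" for m n
      by (simp add: D(2) E(2) mult_ac)
    show "\<psi> (n mod M) * \<chi> (n mod M) = \<psi> n * \<chi> n" for n by (simp add: D(3) E(3))
    show "if coprime n M then \<psi> n * \<chi> n = 1 \<or> \<psi> n * \<chi> n = -1 else \<psi> n * \<chi> n = 0" for n
      using D(4,5)[of n] E(4,5)[of n] by auto
  qed (use M in simp)
  \<comment> \<open>Since \<open>\<chi> g = 1\<close>, the product of \<open>\<psi>\<close> and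
    \<open>\<chi>\<close> is also -1 at \<open>g\<close>. The prime found has
    \<open>\<chi> p = 1\<close>, so its class lies in \<open>H0\<close> and hence in
    \<open>H\<close>, which contradicts \<open>\<psi> p = -1\<close>.\<close>
  obtain p where p: "prime p" "\<psi> p = -1" "\<psi> p * \<chi> p = -1"
    using exists_prime_both_minus_one[OF \<psi> \<psi>\<chi> \<psi>g, of g] \<psi>g g by auto
  then have "\<chi> p = 1" by simp
  then have "split p" unfolding split_def using p(1)
    by (metis prime_gt_0_nat primes_dvd_imp_eq)
  have "[p = p mod M * 1\<^sup>2] (mod M)" by (simp add: cong_def)
  moreover have "p mod M \<in> R" using split_cop[OF \<open>split p\<close>] M unfolding R_def by simp
  ultimately have "p mod M \<in> H0" unfolding H0_def using \<open>split p\<close> coprime_1_left by blast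
  then have "\<psi> p = 1" using H(2) split_cop[OF \<open>split p\<close>] unfolding \<psi>_def by auto
  then show False using p(2) by simp
qed

section \<open>Quadratic reciprocity and the auxiliary divisor\<close>

lemma Legendre_cong: "[a = b] (mod p) \<Longrightarrow> Legendre a p = Legendre b p"
  by (simp add: Legendre_def QuadRes_def cong_def)

lemma abs_Legendre_le: "\<bar>Legendre a p\<bar> \<le> 1" unfolding Legendre_def by auto

lemma Legendre_eq_0_iff: "Legendre a p = 0 \<longleftrightarrow> p dvd a"
  unfolding Legendre_def by (auto simp: cong_0_iff)

text \<open>Turns Euler's congruence for the Legendre symbol into equalities: two numbers among -1,
  0, 1 differ by at most 2.\<close>

lemma signs_eqI:
  fixes x y p :: int
  assumes "[x = y] (mod p)" "\<bar>x\<bar> \<le> 1" "\<bar>y\<bar> \<le> 1" "2 < p"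
  shows "x = y"
proof -
  have "p dvd x - y" using assms(1) by (simp add: cong_iff_dvd_diff)
  moreover have "\<bar>x - y\<bar> < p" using assms by linarith
  ultimately show ?thesis using zdvd_imp_le[of p "\<bar>x - y\<bar>"] by (cases "x = y") auto
qed

lemma Legendre_mult:
  fixes p :: nat
  assumes "prime p" "2 < p"
  shows "Legendre (a * b) p = Legendre a p * Legendre b p"
proof (rule signs_eqI)
  have "[Legendre (a * b) p = (a * b) ^ ((p - 1) div 2)] (mod p)" by (rule euler_criterion[OF assms])
  also have "(a * b) ^ ((p - 1) div 2) = a ^ ((p - 1) div 2) * b ^ ((p - 1) div 2)"
    by (rule power_mult_distrib)
  also have "[\<dots> = Legendre a p * Legendre b p] (mod p)"
    by (intro cong_mult cong_sym[OF euler_criterion[OF assms]])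
  finally show "[Legendre (a * b) p = Legendre a p * Legendre b p] (mod p)" .
  show "\<bar>Legendre a p * Legendre b p\<bar> \<le> 1"
    unfolding abs_mult using abs_Legendre_le by (metis abs_ge_zero mult_le_one)
qed (use assms abs_Legendre_le in auto)

text \<open>On odd \<open>n\<close> this is the nontrivial character modulo 4. Even \<open>n\<close>
  fall into the default branch, hence the oddness hypotheses below.\<close>

definition sign_mod4 :: "nat \<Rightarrow> int" where
  "sign_mod4 n = (if n mod 4 = 1 then 1 else -1)"

lemma sign_mod4_mult:
  assumes "odd a" "odd b"
  shows "sign_mod4 (a * b) = sign_mod4 a * sign_mod4 b"
proof -
  have "a mod 4 = 1 \<or> a mod 4 = 3" "b mod 4 = 1 \<or> b mod 4 = 3" using assms by presburger+
  moreover have "(a * b) mod 4 = (a mod 4) * (b mod 4) mod 4" by (simp add: mod_mult_eq)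
  ultimately show ?thesis unfolding sign_mod4_def by auto
qed

lemma sign_mod4_prod:
  assumes "finite P" "\<And>p. p \<in> P \<Longrightarrow> odd p"
  shows "sign_mod4 (\<Prod>P) = (\<Prod>p\<in>P. sign_mod4 p)"
  using assms
proof (induction P)
  case (insert p P)
  have "odd (\<Prod>P)" using insert by (auto simp: even_prod_iff)
  then show ?case using insert by (simp add: sign_mod4_mult)
qed (simp add: sign_mod4_def)

lemma sign_mod4_eq_power: "odd n \<Longrightarrow> sign_mod4 n = (-1) ^ ((n - 1) div 2)"
proof -
  assume "odd n"
  then have "n mod 4 = 1 \<and> even ((n - 1) div 2) \<or> n mod 4 = 3 \<and> odd ((n - 1) div 2)" by presburger
  then show ?thesis unfolding sign_mod4_def by auto
qed

lemma Legendre_minus_one: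
  assumes "prime p" "2 < p"
  shows "Legendre (-1) (int p) = sign_mod4 p"
proof (rule signs_eqI)
  show "[Legendre (-1) (int p) = sign_mod4 p] (mod int p)"
    using euler_criterion[OF assms, of "-1"] sign_mod4_eq_power[OF prime_odd_nat[OF assms]] by simp
qed (use assms abs_Legendre_le in \<open>auto simp: sign_mod4_def\<close>)

text \<open>The reciprocity law gives the product of the two symbols, and multiplying by one of them
  isolates the other, as its square is 1. The sign is written asymmetrically so that for fixed
  \<open>q\<close> it is multiplicative in \<open>p\<close>.\<close>

lemma Legendre_reciprocity:
  assumes "prime p" "2 < p" "prime q" "2 < q" "p \<noteq> q"
  shows "Legendre (int q) (int p) = Legendre (int p) (int q) * (if q mod 4 = 1 then 1 else sign_mod4 p)"
proof -
  have odd: "odd p" "odd q" using assms prime_odd_nat by auto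
  have "Legendre (int p) (int q) * Legendre (int q) (int p) = (-1) ^ ((p - 1) div 2 * ((q - 1) div 2))"
    using Quadratic_Reciprocity[of p q] assms by simp
  also have "\<dots> = sign_mod4 p ^ ((q - 1) div 2)"
    using sign_mod4_eq_power[OF odd(1)] by (simp add: power_mult)
  also have "\<dots> = (if q mod 4 = 1 then 1 else sign_mod4 p)"
  proof -
    have "q mod 4 = 1 \<and> even ((q - 1) div 2) \<or> q mod 4 \<noteq> 1 \<and> odd ((q - 1) div 2)"
      using odd by presburger
    then show ?thesis unfolding sign_mod4_def by auto
  qed
  finally have *: "Legendre (int p) (int q) * Legendre (int q) (int p) = (if q mod 4 = 1 then 1 else sign_mod4 p)" .
  have "\<not> q dvd p" using assms by (metis primes_dvd_imp_eq)
  then have "Legendre (int p) (int q) \<noteq> 0" by (simp add: Legendre_eq_0_iff)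
  then have "Legendre (int p) (int q) * Legendre (int p) (int q) = 1" unfolding Legendre_def by auto
  then have "Legendre (int q) (int p)
      = Legendre (int p) (int q) * (Legendre (int p) (int q) * Legendre (int q) (int p))"
    by (simp add: mult.assoc[symmetric])
  then show ?thesis unfolding * .
qed

text \<open>For a set of odd primes this is the Jacobi symbol of \<open>n\<close> over their
  product, set to 0 at even \<open>n\<close>; this puts the factor 2 into its modulus and makes
  every prime with a nonzero value odd.\<close>

definition prod_Legendre :: "nat set \<Rightarrow> nat \<Rightarrow> int" where
  "prod_Legendre P n = (if odd n then \<Prod>p\<in>P. Legendre (int n) (int p) else 0)"

lemma quadratic_character_prod_Legendre:
  assumes P: "finite P" "\<And>p. p \<in> P \<Longrightarrow> prime p \<and> 2 < p"
  shows "quadratic_character (2 * \<Prod>P) (prod_Legendre P)"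
  unfolding quadratic_character_def
proof (intro conjI allI)
  have "\<Prod>P > 0" using P prime_gt_0_nat by (intro prod_pos) auto
  then show "2 * \<Prod>P > 0" by simp
  show "prod_Legendre P (m * n) = prod_Legendre P m * prod_Legendre P n" for m n
    using P unfolding prod_Legendre_def by (auto simp: prod.distrib[symmetric] Legendre_mult intro!: prod.cong)
next
  fix n
  have "odd (n mod (2 * \<Prod>P)) = odd n" by (simp add: dvd_mod_iff)
  moreover have "Legendre (int (n mod (2 * \<Prod>P))) (int p) = Legendre (int n) (int p)" if "p \<in> P" for p
  proof -
    have "p dvd 2 * \<Prod>P" by (rule dvd_mult) (rule dvd_prodI[OF P(1) that])
    then have "[n mod (2 * \<Prod>P) = n] (mod p)" by (simp add: cong_def mod_mod_cancel)
    then show ?thesis by (intro Legendre_cong) (simp add: cong_int_iff)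
  qed
  ultimately show "prod_Legendre P (n mod (2 * \<Prod>P)) = prod_Legendre P n"
    unfolding prod_Legendre_def by simp
next
  fix n
  have cop: "coprime n (2 * \<Prod>P) \<longleftrightarrow> odd n \<and> (\<forall>p\<in>P. \<not> p dvd n)"
  proof -
    have "coprime n (\<Prod>P) \<longleftrightarrow> (\<forall>p\<in>P. \<not> p dvd n)"
    proof
      assume *: "coprime n (\<Prod>P)"
      show "\<forall>p\<in>P. \<not> p dvd n"
      proof (intro ballI notI)
        fix p assume "p \<in> P" "p dvd n"
        then have "p dvd \<Prod>P" using dvd_prodI[OF P(1), of p "\<lambda>x. x"] by simp
        then have "p dvd 1" using \<open>p dvd n\<close> * coprime_common_divisor by blast
        then show False using P(2)[OF \<open>p \<in> P\<close>] by auto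
      qed
    next
      assume "\<forall>p\<in>P. \<not> p dvd n"
      then have "\<forall>p\<in>P. coprime n p" using P(2) by (metis prime_imp_coprime coprime_commute)
      then show "coprime n (\<Prod>P)" by (intro prod_coprime_right) auto
    qed
    then show ?thesis by simp
  qed
  show "if coprime n (2 * \<Prod>P) then prod_Legendre P n = 1 \<or> prod_Legendre P n = -1 else prod_Legendre P n = 0"
  proof (cases "coprime n (2 * \<Prod>P)")
    case True
    have "(\<Prod>p\<in>P. Legendre (int n) (int p)) ^ 2 = (\<Prod>p\<in>P. 1)"
      unfolding prod_power_distrib
    proof (rule prod.cong)
      fix p assume "p \<in> P"
      then have "Legendre (int n) (int p) \<noteq> 0" using True unfolding cop by (simp add: Legendre_eq_0_iff)
      then show "(Legendre (int n) (int p))\<^sup>2 = 1" unfolding Legendre_def by auto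
    qed simp
    then have "prod_Legendre P n = 1 \<or> prod_Legendre P n = -1"
      using True unfolding cop prod_Legendre_def by (simp add: power2_eq_1_iff)
    then show ?thesis using True by simp
  next
    case False
    then have "prod_Legendre P n = 0"
      using P(1) unfolding cop prod_Legendre_def by (auto simp: Legendre_eq_0_iff)
    then show ?thesis using False by simp
  qed
qed

text \<open>The signs from the single reciprocity laws multiply to 1 if \<open>q mod 4 = 1\<close>,
  and otherwise to the sign of the product of \<open>P\<close>, which is -1. Either way this is the
  Legendre symbol of -1 modulo \<open>q\<close>.\<close>

lemma prod_Legendre_reciprocity:
  assumes P: "finite P" "\<And>p. p \<in> P \<Longrightarrow> prime p \<and> 2 < p"
    and m: "(\<Prod>P) mod 4 = 3" and q: "prime q" "2 < q" "q \<notin> P"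
  shows "prod_Legendre P q = Legendre (- int (\<Prod>P)) (int q)"
proof -
  define s where "s n = (if q mod 4 = 1 then 1 else sign_mod4 n)" for n
  have Leg: "Legendre (int (\<Prod>S)) (int q) = (\<Prod>p\<in>S. Legendre (int p) (int q))" if "S \<subseteq> P" for S
    using finite_subset[OF that P(1)]
  proof (induction S)
    case empty
    have "\<not> int q dvd 1" using q by simp
    moreover have "QuadRes (int q) 1" unfolding QuadRes_def by (rule exI[of _ 1]) simp
    ultimately show ?case unfolding Legendre_def by (simp add: cong_0_iff)
  next
    case (insert p S)
    then show ?case using Legendre_mult[OF q(1,2)] by simp
  qed
  have "prod_Legendre P q = (\<Prod>p\<in>P. Legendre (int q) (int p))"
    using prime_odd_nat[OF q(1,2)] unfolding prod_Legendre_def by simp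
  also have "\<dots> = (\<Prod>p\<in>P. Legendre (int p) (int q) * s p)"
  proof (rule prod.cong[OF refl])
    fix p assume "p \<in> P"
    then show "Legendre (int q) (int p) = Legendre (int p) (int q) * s p"
      unfolding s_def using P(2) q by (intro Legendre_reciprocity) auto
  qed
  also have "\<dots> = Legendre (int (\<Prod>P)) (int q) * (\<Prod>p\<in>P. s p)"
    by (simp only: prod.distrib Leg[OF order_refl])
  also have "(\<Prod>p\<in>P. s p) = Legendre (-1) (int q)"
  proof -
    have "(\<Prod>p\<in>P. sign_mod4 p) = -1"
      using sign_mod4_prod[OF P(1)] P(2) prime_odd_nat m unfolding sign_mod4_def by simp
    then show ?thesis unfolding Legendre_minus_one[OF q(1,2)] s_def by (simp add: sign_mod4_def)
  qed
  also have "Legendre (int (\<Prod>P)) (int q) * Legendre (-1) (int q) = Legendre (- int (\<Prod>P)) (int q)"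
    using Legendre_mult[OF q(1,2), of "int (\<Prod>P)" "-1"] by simp
  finally show ?thesis .
qed

section \<open>The auxiliary number \<open>q\<close>\<close>

lemma QuadRes_squarefree:
  fixes q :: nat
  assumes "squarefree q" "\<And>p. prime p \<Longrightarrow> p dvd q \<Longrightarrow> QuadRes (int p) a"
  shows "QuadRes (int q) a"
  using assms
proof (induction q rule: prime_divisors_induct)
  case (unit q)
  then show ?case unfolding QuadRes_def by auto
next
  case (factor p q)
  have cop: "coprime p q"
  proof (rule prime_imp_coprime[OF factor.hyps])
    show "\<not> p dvd q"
    proof
      assume "p dvd q"
      then have "p\<^sup>2 dvd p * q" by (simp add: power2_eq_square)
      then have "p dvd 1" by (rule squarefreeD[OF factor.prems(1)])
      then show False using not_prime_unit factor.hyps by blast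
    qed
  qed
  have "squarefree q" using factor.prems(1) squarefree_multD by blast
  then obtain y where y: "[y\<^sup>2 = a] (mod int q)"
    using factor unfolding QuadRes_def by (metis dvd_mult)
  obtain x where x: "[x\<^sup>2 = a] (mod int p)" using factor.prems(2)[OF factor.hyps] unfolding QuadRes_def by auto
  have "coprime (int p) (int q)" using cop by simp
  then obtain z where z: "[z = x] (mod int p)" "[z = y] (mod int q)"
    using binary_chinese_remainder_int by blast
  have "[z\<^sup>2 = a] (mod int p)" using cong_trans[OF cong_pow[OF z(1)] x] .
  moreover have "[z\<^sup>2 = a] (mod int q)" using cong_trans[OF cong_pow[OF z(2)] y] .
  ultimately have "[z\<^sup>2 = a] (mod int p * int q)"
    using \<open>coprime (int p) (int q)\<close> by (rule coprime_cong_mult)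
  then show ?case unfolding QuadRes_def by auto
qed auto

lemma prod_prime_factors_squarefree:
  fixes n :: nat
  assumes "squarefree n"
  shows "\<Prod>(prime_factors n) = n"
proof -
  have "n \<noteq> 0" using assms by (metis not_squarefree_0)
  then have "(\<Prod>p\<in>prime_factors n. p ^ multiplicity p n) = n" by (simp add: prod_prime_factors)
  moreover have "multiplicity p n = 1" if "p \<in> prime_factors n" for p
    using that assms squarefree_factorial_semiring'[OF \<open>n \<noteq> 0\<close>] by auto
  ultimately show ?thesis by simp
qed

text \<open>The numbers are the entries of the symmetric matrix with rows (N, \<alpha>, 0),
  (\<alpha>, P, Q), (0, Q, R), whose second leading minor is \<open>q\<close> and whose determinant
  is \<open>q * R - N * Q\<^sup>2 = 3\<close>. So -q has to be a square modulo \<open>N\<close> and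
  -3N a square modulo \<open>q\<close>; the residue of \<open>q\<close> modulo 3 controls the values
  of the form modulo 9.\<close>

lemma exists_auxiliary_divisor:
  fixes N :: nat
  assumes N: "squarefree N" "N mod 12 = 5"
  shows "\<exists>(q::nat) \<alpha> P Q R. q > 0 \<and> q mod 3 = 1 \<and> \<alpha>\<^sup>2 + int q = int N * P \<and> int N * Q\<^sup>2 + 3 = int q * R"
proof -
  define S where "S = prime_factors N"
  have N6: "odd N" "\<not> 3 dvd N" "N mod 4 = 1" using N(2) by presburger+
  have S: "finite S" "\<And>p. p \<in> S \<Longrightarrow> prime p \<and> 2 < p"
  proof -
    show "finite S" unfolding S_def by simp
    fix p assume "p \<in> S"
    then have "prime p" "p dvd N" unfolding S_def by auto
    moreover have "p \<noteq> 2" using \<open>p dvd N\<close> N6 by auto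
    ultimately show "prime p \<and> 2 < p" using prime_ge_2_nat[of p] by auto
  qed
  have "3 \<notin> S" using N6 unfolding S_def by auto
  have prS: "\<Prod>S = N" unfolding S_def by (rule prod_prime_factors_squarefree[OF N(1)])
  define T where "T = insert 3 S"
  have T: "finite T" "\<And>p. p \<in> T \<Longrightarrow> prime p \<and> 2 < p" using S unfolding T_def by auto
  have prT: "\<Prod>T = 3 * N" unfolding T_def using \<open>3 \<notin> S\<close> S(1) prS by simp
  define M where "M = 6 * N"
  have \<chi>: "quadratic_character M (prod_Legendre T)"
    using quadratic_character_prod_Legendre[OF T] unfolding prT M_def by simp
  note D = quadratic_characterD[OF \<chi>]
  have M: "M > 1" "3 dvd M" "N dvd M" using N(2) unfolding M_def by auto
  have "coprime N 6"
  proof -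
    have "coprime N 2" "coprime N 3" using prime_imp_coprime[of 2 N] prime_imp_coprime[of 3 N] N6
      by (simp_all add: coprime_commute)
    then have "coprime N (2 * 3)" by (simp only: coprime_mult_right_iff)
    then show ?thesis by simp
  qed
  \<comment> \<open>The class of -1 modulo \<open>N\<close> and of 1 modulo 6. Its character value
    is that of -1 modulo \<open>N\<close>, which is 1 because \<open>N mod 4 = 1\<close>.\<close>
  then obtain g where g: "[g = N - 1] (mod N)" "[g = 1] (mod 6)"
    using binary_chinese_remainder_nat by blast
  have gN: "[int g = -1] (mod int N)"
  proof -
    have "[int g = int (N - 1)] (mod int N)" using g(1) by (simp add: cong_int_iff)
    moreover have "int (N - 1) = -1 + int N" using N(2) by (cases N) auto
    ultimately show ?thesis by (simp add: cong_def)
  qed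
  have g6: "g mod 6 = 1" using g(2) by (simp add: cong_def)
  have "prod_Legendre T g = 1"
  proof -
    have odd: "odd g" using g6 by presburger
    have "g mod 3 = 1" using g6 by presburger
    then have "[int g = int 1] (mod int 3)" unfolding cong_int_iff by (simp add: cong_def)
    then have "[int g = 1] (mod 3)" by simp
    then have "Legendre (int g) 3 = Legendre 1 3" by (rule Legendre_cong)
    also have "\<dots> = 1"
    proof -
      have "QuadRes 3 1" unfolding QuadRes_def by (rule exI[of _ 1]) simp
      then show ?thesis unfolding Legendre_def by (simp add: cong_0_iff)
    qed
    finally have L3: "Legendre (int g) 3 = 1" .
    have "(\<Prod>p\<in>S. Legendre (int g) (int p)) = (\<Prod>p\<in>S. sign_mod4 p)"
    proof (rule prod.cong[OF refl])
      fix p assume p: "p \<in> S"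
      then have "int p dvd int N" unfolding S_def by auto
      then have "[int g = -1] (mod int p)" using gN cong_dvd_modulus by blast
      then show "Legendre (int g) (int p) = sign_mod4 p"
        using Legendre_minus_one[of p] S(2)[OF p] Legendre_cong[of "int g" "-1" "int p"] by simp
    qed
    also have "\<dots> = sign_mod4 N" using sign_mod4_prod[OF S(1)] S(2) prime_odd_nat unfolding prS by simp
    also have "\<dots> = 1" using N6 by (simp add: sign_mod4_def)
    finally show ?thesis using odd L3 \<open>3 \<notin> S\<close> S(1) unfolding prod_Legendre_def T_def by simp
  qed
  from exists_split_representative[OF \<chi> M(1) this] obtain q0 s where q0: "q0 > 0" "coprime s M"
    "[q0 = g * s\<^sup>2] (mod M)" "\<And>p. prime p \<Longrightarrow> p dvd q0 \<Longrightarrow> prod_Legendre T p = 1" by blast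
  \<comment> \<open>Only the squarefree part is kept, because square roots modulo its prime divisors
    glue to one modulo \<open>q\<close>. The discarded factor is the square of a unit modulo
    \<open>M\<close>.\<close>
  define q t where "q = squarefree_part q0" and "t = square_part q0"
  have qt: "q0 = q * t\<^sup>2" unfolding q_def t_def by (rule squarefree_decompose)
  have sq: "squarefree q" unfolding q_def by simp
  have q: "q > 0" using qt q0(1) by (cases q) auto
  \<comment> \<open>The value 1 at \<open>p\<close> makes \<open>p\<close> coprime to 6N, and since
    3N is 3 modulo 4, reciprocity turns it into the statement that -3N is a square modulo
    \<open>p\<close>.\<close>
  have pq: "prime p \<and> coprime p M \<and> QuadRes (int p) (- int (3 * N))" if p: "prime p" "p dvd q" for p
  proof -
    have 1: "prod_Legendre T p = 1" using q0(4) p qt by simp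
    then have cop: "coprime p M" using D(5)[of p] by fastforce
    moreover have "M = 2 * (3*N)" unfolding M_def by simp
    ultimately have "coprime p 2" "coprime p (3*N)" by (simp_all only: coprime_mult_right_iff)
    then have "p \<noteq> 2" by auto
    then have p2: "2 < p" using prime_ge_2_nat[OF p(1)] by simp
    have pT: "p \<notin> T"
    proof
      assume "p \<in> T"
      then have "p dvd 3 * N" using dvd_prodI[OF T(1), of p "\<lambda>x. x"] unfolding prT by simp
      then have "p dvd 1" by (rule coprime_common_divisor[OF \<open>coprime p (3*N)\<close> dvd_refl])
      then show False using p(1) by simp
    qed
    have m: "(\<Prod>T) mod 4 = 3" unfolding prT using N6 by presburger
    have "Legendre (- int (3*N)) (int p) = 1"
      using prod_Legendre_reciprocity[OF T m p(1) p2 pT] 1 unfolding prT by simp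
    then have "QuadRes (int p) (- int (3*N))" unfolding Legendre_def by (auto split: if_splits)
    then show ?thesis using p cop by simp
  qed
  have "QuadRes (int q) (- int (3*N))" by (rule QuadRes_squarefree[OF sq]) (use pq in blast)
  then obtain y where y: "[y\<^sup>2 = - int (3*N)] (mod int q)" unfolding QuadRes_def by blast
  have "coprime q0 M"
  proof -
    have "prod_Legendre T q0 = prod_Legendre T (g * s\<^sup>2)"
      using q0(3) D(3)[of q0] D(3)[of "g * s\<^sup>2"] unfolding cong_def by simp
    also have "\<dots> = (prod_Legendre T s)\<^sup>2" using D(2,7) \<open>prod_Legendre T g = 1\<close> by simp
    also have "\<dots> \<noteq> 0" using D(4)[OF q0(2)] by auto
    finally show ?thesis using D(5) by blast
  qed
  then have copq: "coprime q M" and copt: "coprime t M" unfolding qt by auto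
  obtain u where u: "[t * u = 1] (mod M)" using cong_solve_coprime_nat[OF copt] by auto
  have qM: "[q = g * (s * u)\<^sup>2] (mod M)"
  proof -
    have "[q * (t * u)\<^sup>2 = q * 1\<^sup>2] (mod M)" using u by (intro cong_mult cong_pow) auto
    then have "[q = q0 * u\<^sup>2] (mod M)" unfolding qt by (simp add: power_mult_distrib mult.assoc cong_sym)
    also have "[q0 * u\<^sup>2 = (g * s\<^sup>2) * u\<^sup>2] (mod M)" using q0(3) by (intro cong_mult) auto
    finally show ?thesis by (simp add: power_mult_distrib mult.assoc)
  qed
  have "coprime q 3" using copq M(2) by (meson coprime_divisors dvd_refl)
  then have "\<not> 3 dvd q" by (auto simp: coprime_absorb_right)
  have "q mod 3 = 1"
  proof -
    have "[q = g * (s * u)\<^sup>2] (mod 3)" using qM M(2) cong_dvd_modulus_nat by blast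
    moreover have "g mod 3 = 1" using g6 by presburger
    then have "[g = 1] (mod 3)" by (simp add: cong_def)
    ultimately have "[q = 1 * (s * u)\<^sup>2] (mod 3)" by (meson cong_mult cong_refl cong_trans)
    then have *: "q mod 3 = (s * u)\<^sup>2 mod 3" by (simp add: cong_def)
    have "(s * u)\<^sup>2 mod 3 = ((s * u) mod 3)\<^sup>2 mod 3" by (simp add: power_mod)
    moreover have "(s * u) mod 3 = 0 \<or> (s * u) mod 3 = 1 \<or> (s * u) mod 3 = 2" by presburger
    ultimately have "q mod 3 = 0 \<or> q mod 3 = 1" using * by auto
    then show ?thesis using \<open>\<not> 3 dvd q\<close> by presburger
  qed
  have "int N dvd (int (s * u))\<^sup>2 + int q"
  proof -
    have "[q = g * (s * u)\<^sup>2] (mod N)" using qM M(3) cong_dvd_modulus_nat by blast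
    then have "[int q = int (g * (s * u)\<^sup>2)] (mod int N)" by (simp only: cong_int_iff)
    then have "[int q = int g * (int (s * u))\<^sup>2] (mod int N)" by (simp only: of_nat_mult of_nat_power)
    also have "[int g * (int (s * u))\<^sup>2 = -1 * (int (s * u))\<^sup>2] (mod int N)"
      by (intro cong_mult gN) simp
    finally show ?thesis by (simp add: cong_iff_dvd_diff add.commute)
  qed
  then obtain P where P: "(int (s * u))\<^sup>2 + int q = int N * P" by blast
  have copN: "coprime (int N) (int q)" using coprime_divisors[OF dvd_refl M(3) copq] by (simp add: coprime_commute)
  then obtain v where v: "[int N * v = 1] (mod int q)" using cong_solve_coprime_int by blast
  \<comment> \<open>Here \<open>Q = y * v\<close>, the root of -3N divided by \<open>N\<close>
    modulo \<open>q\<close>. The congruence is checked after multiplication by \<open>N\<close>,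
    which is then cancelled.\<close>
  have "int q dvd int N * (y * v)\<^sup>2 + 3"
  proof -
    have "[int N * (int N * (y * v)\<^sup>2) = 1\<^sup>2 * y\<^sup>2] (mod int q)"
    proof -
      have "int N * (int N * (y * v)\<^sup>2) = (int N * v)\<^sup>2 * y\<^sup>2" by (simp add: power2_eq_square)
      then show ?thesis using cong_mult[OF cong_pow[OF v, of 2] cong_refl[of "y\<^sup>2"]] by simp
    qed
    also have "[1\<^sup>2 * y\<^sup>2 = - int (3*N)] (mod int q)" using y by simp
    finally have "int q dvd int N * (int N * (y * v)\<^sup>2) - (- int (3*N))" by (simp only: cong_iff_dvd_diff)
    then have "int q dvd int N * (int N * (y * v)\<^sup>2 + 3)" by (simp add: algebra_simps)
    then show ?thesis using copN by (simp add: coprime_dvd_mult_right_iff coprime_commute)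
  qed
  then obtain R where "int N * (y * v)\<^sup>2 + 3 = int q * R" by blast
  then show ?thesis using P q \<open>q mod 3 = 1\<close> by blast
qed

section \<open>Ternary forms of determinant 3\<close>

text \<open>The Gram matrix has rows (a, b, c), (b, d, e), (c, e, h); cross terms carry a factor
  2.\<close>

definition ternary_form :: "int \<Rightarrow> int \<Rightarrow> int \<Rightarrow> int \<Rightarrow> int \<Rightarrow> int \<Rightarrow> int \<Rightarrow> int \<Rightarrow> int \<Rightarrow> int" where
  "ternary_form a b c d e h x y z = a*x\<^sup>2 + 2*b*x*y + 2*c*x*z + d*y\<^sup>2 + 2*e*y*z + h*z\<^sup>2"

text \<open>Positive definiteness is expressed by leading minors, the third being the determinant 3.
  The condition modulo 9 concerns only the set of values, so it survives unimodular substitutions;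
  it stands in for membership in the genus.\<close>

definition represents_det3 :: "int \<Rightarrow> int \<Rightarrow> int \<Rightarrow> int \<Rightarrow> int \<Rightarrow> int \<Rightarrow> int \<Rightarrow> bool" where
  "represents_det3 n a b c d e h \<longleftrightarrow> a > 0 \<and> a*d - b\<^sup>2 > 0 \<and>
     a*d*h + 2*b*c*e - a*e\<^sup>2 - d*c\<^sup>2 - h*b\<^sup>2 = 3 \<and>
     (\<exists>x y z. ternary_form a b c d e h x y z = n) \<and>
     (\<forall>x y z. ternary_form a b c d e h x y z mod 9 \<noteq> 6)"

section \<open>Unimodular changes of variables\<close>

lemma represents_det3_swap12:
  assumes "represents_det3 n a b c d e h"
  shows "represents_det3 n d b e a c h"
proof -
  have eq: "ternary_form d b e a c h x y z = ternary_form a b c d e h y x z" for x y z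
    by (simp add: ternary_form_def algebra_simps)
  have "a * d > 0" using assms zero_le_power2[of b] unfolding represents_det3_def by linarith
  then have "d > 0" using assms unfolding represents_det3_def by (simp add: zero_less_mult_iff)
  then show ?thesis using assms unfolding represents_det3_def eq
    by (auto simp: algebra_simps)
qed

text \<open>A 2 by 2 minor of the adjugate matrix equals an entry of the matrix times the
  determinant 3. As the right side is positive, so is the other minor.\<close>

lemma represents_det3_minor:
  assumes "represents_det3 n a b c d e h"
  shows "(a*d - b\<^sup>2) * (a*h - c\<^sup>2) = 3*a + (a*e - b*c)\<^sup>2" "a*h - c\<^sup>2 > 0"
proof -
  have "(a*d - b\<^sup>2) * (a*h - c\<^sup>2) = a * (a*d*h + 2*b*c*e - a*e\<^sup>2 - d*c\<^sup>2 - h*b\<^sup>2) + (a*e - b*c)\<^sup>2"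
    by (simp add: algebra_simps power2_eq_square)
  then show *: "(a*d - b\<^sup>2) * (a*h - c\<^sup>2) = 3*a + (a*e - b*c)\<^sup>2"
    using assms unfolding represents_det3_def by simp
  have "(a*d - b\<^sup>2) * (a*h - c\<^sup>2) > 0" unfolding * using assms zero_le_power2[of "a*e - b*c"]
    unfolding represents_det3_def by linarith
  then show "a*h - c\<^sup>2 > 0"
    using assms unfolding represents_det3_def by (simp add: zero_less_mult_iff)
qed

lemma represents_det3_swap23:
  assumes "represents_det3 n a b c d e h"
  shows "represents_det3 n a c b h e d"
proof -
  have eq: "ternary_form a c b h e d x y z = ternary_form a b c d e h x z y" for x y z
    by (simp add: ternary_form_def algebra_simps)
  show ?thesis using assms represents_det3_minor[OF assms] unfolding represents_det3_def eq
    by (auto simp: algebra_simps)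
qed

text \<open>Comes from substituting \<open>x + t*y\<close> for \<open>x\<close>; \<open>a\<close>
  and the minor \<open>a*d - b\<^sup>2\<close> stay fixed, which is what reduction relies
  on.\<close>

lemma represents_det3_shear12:
  assumes "represents_det3 n a b c d e h"
  shows "represents_det3 n a (b + t*a) c (d + 2*t*b + t\<^sup>2*a) (e + t*c) h"
proof -
  have eq: "ternary_form a (b + t*a) c (d + 2*t*b + t\<^sup>2*a) (e + t*c) h x y z
      = ternary_form a b c d e h (x + t*y) y z" for x y z
    by (simp add: ternary_form_def algebra_simps power2_eq_square)
  obtain x y z where "ternary_form a b c d e h x y z = n"
    using assms unfolding represents_det3_def by blast
  then have "ternary_form a b c d e h ((x - t*y) + t*y) y z = n" by simp
  then have "\<exists>x y z. ternary_form a b c d e h (x + t*y) y z = n" by blast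
  moreover have "a * (d + 2*t*b + t\<^sup>2*a) - (b + t*a)\<^sup>2 = a*d - b\<^sup>2"
    by (simp add: algebra_simps power2_eq_square)
  moreover have "a*(d + 2*t*b + t\<^sup>2*a)*h + 2*(b + t*a)*c*(e + t*c) - a*(e + t*c)\<^sup>2 - (d + 2*t*b + t\<^sup>2*a)*c\<^sup>2 - h*(b + t*a)\<^sup>2
      = a*d*h + 2*b*c*e - a*e\<^sup>2 - d*c\<^sup>2 - h*b\<^sup>2"
    by (simp add: algebra_simps power2_eq_square)
  ultimately show ?thesis using assms unfolding represents_det3_def eq by simp
qed

lemma represents_det3_shear23:
  assumes "represents_det3 n a b c d e h"
  shows "represents_det3 n a b (c + t*b) d (e + t*d) (h + 2*t*e + t\<^sup>2*d)"
proof -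
  have eq: "ternary_form a b (c + t*b) d (e + t*d) (h + 2*t*e + t\<^sup>2*d) x y z
      = ternary_form a b c d e h x (y + t*z) z" for x y z
    by (simp add: ternary_form_def algebra_simps power2_eq_square)
  obtain x y z where "ternary_form a b c d e h x y z = n"
    using assms unfolding represents_det3_def by blast
  then have "ternary_form a b c d e h x ((y - t*z) + t*z) z = n" by simp
  then have "\<exists>x y z. ternary_form a b c d e h x (y + t*z) z = n" by blast
  moreover have "a*d*(h + 2*t*e + t\<^sup>2*d) + 2*b*(c + t*b)*(e + t*d) - a*(e + t*d)\<^sup>2 - d*(c + t*b)\<^sup>2 - (h + 2*t*e + t\<^sup>2*d)*b\<^sup>2
      = a*d*h + 2*b*c*e - a*e\<^sup>2 - d*c\<^sup>2 - h*b\<^sup>2"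
    by (simp add: algebra_simps power2_eq_square)
  ultimately show ?thesis using assms unfolding represents_det3_def eq by simp
qed

section \<open>Reduction of ternary forms of determinant 3\<close>

lemma exists_centred_residue:
  fixes a b :: int
  assumes "a > 0"
  shows "\<exists>t. 2 * \<bar>b + t*a\<bar> \<le> a"
proof -
  define q r where "q = (2*b + a) div (2*a)" and "r = (2*b + a) mod (2*a)"
  have "q * (2*a) + r = 2*b + a" unfolding q_def r_def by (rule div_mult_mod_eq)
  then have "2 * (b + (- q)*a) = r - a" by (simp add: algebra_simps)
  moreover have "0 \<le> r" "r < 2*a" unfolding r_def using assms by auto
  ultimately have "2 * \<bar>b + (- q)*a\<bar> \<le> a" by linarith
  then show ?thesis by blast
qed

text \<open>The first two leading minors are positive integers, so the pair has a lexicographic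
  minimum, found by two successive uses of the least number principle.\<close>

lemma represents_det3_minimal:
  assumes "represents_det3 n a0 b0 c0 d0 e0 h0"
  shows "\<exists>a b c d e h. represents_det3 n a b c d e h \<and>
    (\<forall>a' b' c' d' e' h'. represents_det3 n a' b' c' d' e' h' \<longrightarrow>
       a \<le> a' \<and> (a' = a \<longrightarrow> a*d - b\<^sup>2 \<le> a'*d' - b'\<^sup>2))"
proof -
  define P where "P k \<longleftrightarrow> (\<exists>b c d e h. represents_det3 n (int k) b c d e h)" for k
  have pos: "a > 0" "a*d - b\<^sup>2 > 0" if "represents_det3 n a b c d e h" for a b c d e h
    using that unfolding represents_det3_def by auto
  have P: "P (nat a)" if "represents_det3 n a b c d e h" for a b c d e h
    using that pos(1)[OF that] unfolding P_def by (metis int_nat_eq less_imp_le)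
  define k where "k = (LEAST k. P k)"
  have Pk: "P k" unfolding k_def by (rule LeastI, rule P, rule assms)
  have kmin: "k \<le> nat a" if "represents_det3 n a b c d e h" for a b c d e h
    unfolding k_def by (rule Least_le, rule P, rule that)
  define Q where "Q l \<longleftrightarrow> (\<exists>b c d e h. represents_det3 n (int k) b c d e h \<and> int l = int k*d - b\<^sup>2)" for l
  have Q: "Q (nat (int k*d - b\<^sup>2))" if "represents_det3 n (int k) b c d e h" for b c d e h
    using that pos(2)[OF that] unfolding Q_def by (metis int_nat_eq less_imp_le)
  define l where "l = (LEAST l. Q l)"
  have "Q l" unfolding l_def using Pk Q LeastI unfolding P_def by metis
  then obtain b c d e h where R: "represents_det3 n (int k) b c d e h" "int l = int k*d - b\<^sup>2"
    unfolding Q_def by blast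
  have lmin: "int l \<le> int k*d - b\<^sup>2" if "represents_det3 n (int k) b c d e h" for b c d e h
    using Least_le[of Q, OF Q[OF that]] pos(2)[OF that] unfolding l_def by linarith
  show ?thesis
  proof (intro exI conjI allI impI)
    show "represents_det3 n (int k) b c d e h" by (rule R)
  next
    fix a' b' c' d' e' h' assume *: "represents_det3 n a' b' c' d' e' h'"
    show "int k \<le> a'" using kmin[OF *] pos(1)[OF *] by linarith
    assume "a' = int k"
    then show "int k*d - b\<^sup>2 \<le> a'*d' - b'\<^sup>2" using * lmin R(2) by auto
  qed
qed

text \<open>Besides \<open>x\<^sup>2 + y\<^sup>2 + 3z\<^sup>2\<close> there is one more class of determinant 3, that of
  \<open>x\<^sup>2 + 2(y\<^sup>2 + yz + z\<^sup>2)\<close>, and it takes the value 6.\<close>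

lemma represents_det3_imp_sum:
  assumes "represents_det3 n a0 b0 c0 d0 e0 h0"
  shows "\<exists>x y z. n = x\<^sup>2 + y\<^sup>2 + 3*z\<^sup>2"
proof -
  obtain a b1 c1 d1 e1 h1 where R1: "represents_det3 n a b1 c1 d1 e1 h1" and
    min: "\<And>a' b' c' d' e' h'. represents_det3 n a' b' c' d' e' h' \<Longrightarrow>
       a \<le> a' \<and> (a' = a \<longrightarrow> a*d1 - b1\<^sup>2 \<le> a'*d' - b'\<^sup>2)"
    using represents_det3_minimal[OF assms] by blast
  define A where "A = a*d1 - b1\<^sup>2"
  have a: "a > 0" and A: "A > 0" using R1 unfolding represents_det3_def A_def by auto
  \<comment> \<open>The shear by \<open>t\<close> changes \<open>a*e - b*c\<close> by
    \<open>t*A\<close>, so that this entry can be made at most \<open>A/2\<close> in size. The later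
    shear by \<open>u\<close> reduces \<open>b\<close> modulo \<open>a\<close> and leaves it and
    \<open>A\<close> alone.\<close>
  obtain t where t: "2 * \<bar>(a*e1 - b1*c1) + t*A\<bar> \<le> A" using exists_centred_residue[OF A] by blast
  note R2 = represents_det3_shear23[OF R1, of t]
  obtain u where u: "2 * \<bar>b1 + u*a\<bar> \<le> a" using exists_centred_residue[OF a] by blast
  note R3 = represents_det3_shear12[OF R2, of u]
  define b c d e h where "b = b1 + u*a" and "c = c1 + t*b1" and
    "d = d1 + 2*u*b1 + u\<^sup>2*a" and "e = e1 + t*d1 + u*(c1 + t*b1)" and
    "h = h1 + 2*t*e1 + t\<^sup>2*d1"
  have R: "represents_det3 n a b c d e h" using R3 unfolding b_def c_def d_def e_def h_def by simp
  define B C where "B = a*e - b*c" and "C = a*h - c\<^sup>2"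
  have A': "a*d - b\<^sup>2 = A" unfolding A_def b_def d_def by (simp add: algebra_simps power2_eq_square)
  have "B = (a*e1 - b1*c1) + t*A" unfolding B_def b_def c_def e_def A_def
    by (simp add: algebra_simps power2_eq_square)
  then have B: "2 * \<bar>B\<bar> \<le> A" using t by simp
  have b: "2 * \<bar>b\<bar> \<le> a" using u unfolding b_def by simp
  have AC: "A * C = 3*a + B\<^sup>2" using represents_det3_minor(1)[OF R] unfolding A' B_def C_def by simp
  \<comment> \<open>Exchanging the last two variables keeps \<open>a\<close> and replaces the minor
    \<open>A\<close> by \<open>C\<close>. With \<open>4*B\<^sup>2 \<le> A\<^sup>2\<close> this gives
    \<open>A\<^sup>2 \<le> 4*a\<close>.\<close>
  have "A \<le> C" using min[OF represents_det3_swap23[OF R]] unfolding A_def C_def by simp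
  then have "A * A \<le> A * C" using A by (intro mult_left_mono) auto
  moreover have "4 * B\<^sup>2 \<le> A\<^sup>2" using power_mono[OF B, of 2] by (simp add: power_mult_distrib)
  ultimately have A2: "A\<^sup>2 \<le> 4*a" using AC by (simp add: power2_eq_square)
  \<comment> \<open>Exchanging the first two variables puts \<open>d\<close> in front. With
    \<open>4*b\<^sup>2 \<le> a\<^sup>2\<close> this gives \<open>3*a\<^sup>2 \<le> 4*A\<close>; both
    estimates together leave only \<open>a = 1\<close>.\<close>
  have "a \<le> d" using min[OF represents_det3_swap12[OF R]] by simp
  then have "a * a \<le> a * d" using a by (intro mult_left_mono) auto
  moreover have "4 * b\<^sup>2 \<le> a\<^sup>2" using power_mono[OF b, of 2] by (simp add: power_mult_distrib)
  ultimately have "3*a\<^sup>2 \<le> 4*A" using A' by (simp add: power2_eq_square)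
  then have "(3*a\<^sup>2)\<^sup>2 \<le> (4*A)\<^sup>2" by (intro power_mono) auto
  also have "\<dots> \<le> 64*a" using A2 by (simp add: power_mult_distrib)
  finally have "a * (9*a^3) \<le> a * 64" by (simp add: power_mult_distrib algebra_simps power_numeral_reduce)
  then have a3: "9*a^3 \<le> 64" using a by simp
  have "a = 1"
  proof (rule ccontr)
    assume "a \<noteq> 1"
    then have "2^3 \<le> a^3" using a by (intro power_mono) auto
    then show False using a3 by simp
  qed
  then have "b = 0" using b by auto
  have val: "ternary_form a b c d e h x y z = (x + c*z)\<^sup>2 + A*y\<^sup>2 + 2*B*y*z + C*z\<^sup>2" for x y z
    using A' \<open>a = 1\<close> \<open>b = 0\<close> unfolding ternary_form_def B_def C_def
    by (simp add: algebra_simps power2_eq_square)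
  have "A \<le> 2" 
  proof (rule ccontr)
    assume "\<not> A \<le> 2"
    then have "3^2 \<le> A^2" by (intro power_mono) auto
    then show False using A2 \<open>a = 1\<close> by simp
  qed
  then consider "A = 1" | "A = 2" using A by linarith
  then show ?thesis
  proof cases
    case 1
    then have "B = 0" using B by auto
    then have "C = 3" using AC 1 \<open>a = 1\<close> by simp
    obtain x y z where "ternary_form a b c d e h x y z = n"
      using R unfolding represents_det3_def by blast
    then have "n = (x + c*z)\<^sup>2 + y\<^sup>2 + 3*z\<^sup>2" unfolding val using 1 \<open>B = 0\<close> \<open>C = 3\<close> by simp
    then show ?thesis by blast
  next
    case 2
    \<comment> \<open>The other class is recognized by its value 6, which the condition modulo 9
      forbids.\<close>
    then have "ternary_form a b c d e h 2 1 0 = 6" unfolding val by simp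
    moreover have "ternary_form a b c d e h 2 1 0 mod 9 \<noteq> 6"
      using R unfolding represents_det3_def by blast
    ultimately show ?thesis by simp
  qed
qed

section \<open>Representation of numbers congruent to 5 modulo 12\<close>

lemma square_mod_3: "(x::int)\<^sup>2 mod 3 = (if 3 dvd x then 0 else 1)"
proof -
  have "x mod 3 = 0 \<or> x mod 3 = 1 \<or> x mod 3 = 2" by presburger
  then show ?thesis
    unfolding power_mod[of x 3 2, symmetric] dvd_eq_mod_eq_0 by (elim disjE) simp_all
qed

text \<open>Completing squares turns \<open>N*q\<close> times the form into
  \<open>q*u\<^sup>2 + s\<^sup>2 + 3*N*z\<^sup>2\<close>. A value 6 modulo 9 would force 3 to divide
  \<open>u\<close> and \<open>s\<close>, and after division by 3 \<open>z\<^sup>2\<close> would be 2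
  modulo 3.\<close>

lemma ternary_form_mod_9:
  fixes N q :: int
  assumes N: "N mod 3 = 2" and q: "q mod 3 = 1"
    and P: "\<alpha>\<^sup>2 + q = N * P" and R: "N * Q\<^sup>2 + 3 = q * R"
  shows "ternary_form N \<alpha> 0 P Q R x y z mod 9 \<noteq> 6"
proof
  define f where "f = ternary_form N \<alpha> 0 P Q R x y z"
  define u s where "u = N*x + \<alpha>*y" and "s = q*y + N*Q*z"
  assume "ternary_form N \<alpha> 0 P Q R x y z mod 9 = 6"
  then have "f mod 9 = 6" unfolding f_def .
  then obtain k where f: "f = 9*k + 6" using mult_div_mod_eq[of 9 f] by metis
  have "N*q*f = q*u\<^sup>2 + q*y\<^sup>2*(N*P - \<alpha>\<^sup>2) + 2*N*q*Q*y*z + N*z\<^sup>2*(q*R)"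
    unfolding f_def ternary_form_def u_def by (simp add: algebra_simps power2_eq_square)
  also have "N*P - \<alpha>\<^sup>2 = q" using P by simp
  also have "q*u\<^sup>2 + q*y\<^sup>2*q + 2*N*q*Q*y*z + N*z\<^sup>2*(q*R) = q*u\<^sup>2 + s\<^sup>2 + 3*N*z\<^sup>2"
    unfolding R[symmetric] s_def by (simp add: algebra_simps power2_eq_square)
  finally have eq: "N*q*f = q*u\<^sup>2 + s\<^sup>2 + 3*N*z\<^sup>2" .
  obtain i where i: "q = 3*i + 1" using q mult_div_mod_eq[of 3 q] by metis
  have "u\<^sup>2 + s\<^sup>2 = 3*(N*q*(3*k + 2) - i*u\<^sup>2 - N*z\<^sup>2)"
    using eq unfolding f i by (simp add: algebra_simps)
  then have "(u\<^sup>2 mod 3 + s\<^sup>2 mod 3) mod 3 = 0" by (simp add: mod_add_eq)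
  then have "3 dvd u" "3 dvd s" unfolding square_mod_3 by (auto split: if_splits)
  then obtain u' s' where us: "u = 3*u'" "s = 3*s'" by (auto elim!: dvdE)
  have "3*(N*q*(3*k + 2)) = 3*(3*q*u'\<^sup>2 + 3*s'\<^sup>2 + N*z\<^sup>2)"
    using eq unfolding f us by (simp add: algebra_simps power2_eq_square)
  then have "N*z\<^sup>2 = N*q*(3*k + 2) - 3*q*u'\<^sup>2 - 3*s'\<^sup>2" by simp
  moreover obtain j where j: "N = 3*j + 2" using N mult_div_mod_eq[of 3 N] by metis
  ultimately have "2*z\<^sup>2 = 4 + 3*(N*q*k + 2*j*q + 4*i - q*u'\<^sup>2 - s'\<^sup>2 - j*z\<^sup>2)"
    unfolding i by (simp add: algebra_simps)
  then obtain W where "2*z\<^sup>2 = 4 + 3*W" by blast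
  then have "(2*z\<^sup>2) mod 3 = 1" by presburger
  moreover have "z\<^sup>2 mod 3 \<noteq> 2" unfolding square_mod_3 by simp
  ultimately show False by presburger
qed

lemma sum_113_squarefree:
  fixes N :: nat
  assumes "squarefree N" "N mod 12 = 5"
  shows "\<exists>x y z. int N = x\<^sup>2 + y\<^sup>2 + 3*z\<^sup>2"
proof -
  obtain q :: nat and \<alpha> P Q R where q: "q > 0" "q mod 3 = 1"
    and P: "\<alpha>\<^sup>2 + int q = int N * P" and R: "int N * Q\<^sup>2 + 3 = int q * R"
    using exists_auxiliary_divisor[OF assms] by blast
  have "N mod 3 = 2" using assms(2) by presburger
  then have N3: "int N mod 3 = 2" using zmod_int[of N 3] by simp
  have q3: "int q mod 3 = 1" using zmod_int[of q 3] q(2) by simp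
  have "ternary_form (int N) \<alpha> 0 P Q R 1 0 0 = int N" by (simp add: ternary_form_def)
  moreover have "int N > 0" using assms(2) by (cases N) auto
  moreover have "int N * P * R - int N * Q\<^sup>2 - R * \<alpha>\<^sup>2 = 3"
  proof -
    have "int N * P * R - int N * Q\<^sup>2 - R * \<alpha>\<^sup>2 = (\<alpha>\<^sup>2 + int q) * R - int N * Q\<^sup>2 - R * \<alpha>\<^sup>2"
      unfolding P ..
    also have "\<dots> = int q * R - int N * Q\<^sup>2" by (simp add: algebra_simps)
    finally show ?thesis using R by simp
  qed
  moreover have "int N * P - \<alpha>\<^sup>2 > 0" using P q(1) by simp
  ultimately have "represents_det3 (int N) (int N) \<alpha> 0 P Q R"
    unfolding represents_det3_def using ternary_form_mod_9[OF N3 q3 P R] by auto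
  then show ?thesis by (rule represents_det3_imp_sum)
qed

text \<open>The square factor comes from a number coprime to 12, whose square is 1 modulo 12; so the
  squarefree part is still 5 modulo 12, and its representation can be scaled.\<close>

theorem sum_113:
  fixes n :: int
  assumes "n > 0" "n mod 12 = 5"
  shows "\<exists>x y z. n = x\<^sup>2 + y\<^sup>2 + 3*z\<^sup>2"
proof -
  define N k where "N = squarefree_part (nat n)" and "k = square_part (nat n)"
  have n: "n = int N * (int k)\<^sup>2"
    using squarefree_decompose[of "nat n"] assms(1) unfolding N_def k_def
    by (metis int_nat_eq less_imp_le of_nat_mult of_nat_power)
  have "odd n" "\<not> 3 dvd n" using assms(2) by presburger+
  then have "odd (int k)" "\<not> 3 dvd int k" unfolding n by auto
  then have "int k mod 12 = 1 \<or> int k mod 12 = 5 \<or> int k mod 12 = 7 \<or> int k mod 12 = 11" by presburger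
  then have k: "(int k)\<^sup>2 mod 12 = 1"
    unfolding power_mod[of "int k" 12 2, symmetric] by (elim disjE) simp_all
  have "n mod 12 = (int N * ((int k)\<^sup>2 mod 12)) mod 12" unfolding n by (simp add: mod_mult_right_eq)
  then have "int N mod 12 = 5" using assms(2) unfolding k by simp
  then have "int (N mod 12) = int 5" by (simp add: zmod_int)
  then have "N mod 12 = 5" by (simp only: of_nat_eq_iff)
  moreover have "squarefree N" unfolding N_def by simp
  ultimately obtain x y z where "int N = x\<^sup>2 + y\<^sup>2 + 3*z\<^sup>2" using sum_113_squarefree by blast
  then have "n = (int k*x)\<^sup>2 + (int k*y)\<^sup>2 + 3*(int k*z)\<^sup>2"
    unfolding n by (simp add: power_mult_distrib algebra_simps)
  then show ?thesis by blast
qed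

section \<open>Cauchy's method\<close>

text \<open>For a solution, \<open>X = 3*w - x - y - z\<close>, \<open>Y = 2*x - y - z\<close> and
  \<open>Z = y - z\<close> satisfy the first equation identically. The congruences make the inverse
  of this substitution integral.\<close>

lemma cauchy_lemma_3111:
  fixes A B X Y Z :: int
  assumes eq: "6*A - B\<^sup>2 = X\<^sup>2 + Y\<^sup>2 + 3*Z\<^sup>2" and X: "6 dvd X + B"
    and YZ: "even (Y - Z)" and Y: "3 dvd Y + B"
    and B: "B \<ge> 0" "5*A < B\<^sup>2 + 2*B + 6"
  shows "\<exists>w x y z :: nat. 3*(int w)\<^sup>2 + (int x)\<^sup>2 + (int y)\<^sup>2 + (int z)\<^sup>2 = A \<and>
    3*int w + int x + int y + int z = B"
proof -
  obtain w where w: "X = 6*w - B" using X by (auto elim!: dvdE simp: algebra_simps)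
  obtain p where "Y - Z = 2*p" using YZ by (rule evenE)
  then have p: "Y = 2*p + Z" by simp
  have "3 dvd B - 3*w - p - 2*Z"
    using Y unfolding p by presburger
  then obtain z where z: "B = 3*w + p + 2*Z + 3*z" by (auto elim!: dvdE simp: algebra_simps)
  define y x where "y = z + Z" and "x = z + Z + p"
  have Beq: "B = 3*w + x + y + z" unfolding z y_def x_def by simp
  have "6*A = 6*(3*w\<^sup>2 + x\<^sup>2 + y\<^sup>2 + z\<^sup>2)"
    using eq unfolding w p z x_def y_def by (simp add: algebra_simps power2_eq_square)
  then have Aeq: "A = 3*w\<^sup>2 + x\<^sup>2 + y\<^sup>2 + z\<^sup>2" by simp
  \<comment> \<open>\<open>5*A\<close> is at least \<open>5*u\<^sup>2 + (B - u)\<^sup>2\<close>, by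
    Cauchy-Schwarz with an explicit sum of squares. For \<open>u \<le> -1\<close> this is at least
    \<open>5 + (B + 1)\<^sup>2\<close>, exactly the excluded bound.\<close>
  have nonneg: "u \<ge> 0" if u: "A = 3*w\<^sup>2 + u\<^sup>2 + v\<^sup>2 + t\<^sup>2" "B = 3*w + u + v + t" for u v t
  proof (rule ccontr)
    assume "\<not> u \<ge> 0"
    then have "u\<^sup>2 \<ge> 1" using power_mono[of 1 "-u" 2] by simp
    moreover have "(B - u)\<^sup>2 \<ge> (B + 1)\<^sup>2" using \<open>\<not> u \<ge> 0\<close> B by (intro power_mono) auto
    moreover have "5*A = 5*u\<^sup>2 + (B - u)\<^sup>2 + (3*(w - v)\<^sup>2 + 3*(w - t)\<^sup>2 + (v - t)\<^sup>2)"
      unfolding u by (simp add: algebra_simps power2_eq_square)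
    moreover have "3*(w - v)\<^sup>2 + 3*(w - t)\<^sup>2 + (v - t)\<^sup>2 \<ge> 0" by simp
    moreover have "(B + 1)\<^sup>2 = B\<^sup>2 + 2*B + 1" by (simp add: algebra_simps power2_eq_square)
    ultimately show False using B by linarith
  qed
  have "x \<ge> 0" by (rule nonneg[of x y z]) (use Aeq Beq in auto)
  moreover have "y \<ge> 0" by (rule nonneg[of y x z]) (use Aeq Beq in auto)
  moreover have "z \<ge> 0" by (rule nonneg[of z x y]) (use Aeq Beq in auto)
  moreover have "w \<ge> 0"
  proof (rule ccontr)
    assume "\<not> w \<ge> 0"
    then have "w\<^sup>2 \<ge> 1" using power_mono[of 1 "-w" 2] by simp
    moreover have "(B - 3*w)\<^sup>2 \<ge> (B + 3)\<^sup>2" using \<open>\<not> w \<ge> 0\<close> B by (intro power_mono) auto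
    moreover have "3*A = 9*w\<^sup>2 + (B - 3*w)\<^sup>2 + ((x - y)\<^sup>2 + (x - z)\<^sup>2 + (y - z)\<^sup>2)"
      unfolding Aeq Beq by (simp add: algebra_simps power2_eq_square)
    moreover have "(x - y)\<^sup>2 + (x - z)\<^sup>2 + (y - z)\<^sup>2 \<ge> 0" "A \<ge> 0" unfolding Aeq by simp_all
    moreover have "(B + 3)\<^sup>2 = B\<^sup>2 + 6*B + 9" by (simp add: algebra_simps power2_eq_square)
    ultimately show False using B by linarith
  qed
  ultimately have "3*(int (nat w))\<^sup>2 + (int (nat x))\<^sup>2 + (int (nat y))\<^sup>2 + (int (nat z))\<^sup>2 = A \<and>
    3*int (nat w) + int (nat x) + int (nat y) + int (nat z) = B" using Aeq Beq by simp
  then show ?thesis by blast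
qed

section \<open>Congruence conditions on the pair \<open>(A, B)\<close>\<close>

lemma mod_add_mult_mod:
  fixes m x y z :: int
  shows "(x + y * (z mod m)) mod m = (x + y * z) mod m"
  by (metis mod_add_right_eq mod_mult_right_eq)

lemma square_mod_4: "(x::int)\<^sup>2 mod 4 = (if odd x then 1 else 0)"
proof -
  have odd_iff: "odd x \<longleftrightarrow> x mod 4 = 1 \<or> x mod 4 = 3" by presburger
  have "x mod 4 = 0 \<or> x mod 4 = 1 \<or> x mod 4 = 2 \<or> x mod 4 = 3" by presburger
  then show ?thesis
    unfolding power_mod[of x 4 2, symmetric] odd_iff by (elim disjE) simp_all
qed

text \<open>Modulo 4 exactly one of \<open>X\<close> and \<open>Y\<close> is odd with the other of
  the same parity as \<open>Z\<close>; if it is \<open>Y\<close>, the two are exchanged.\<close>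

lemma sum_113_parity:
  fixes n X Y Z :: int
  assumes "n mod 4 = 1" "n = X\<^sup>2 + Y\<^sup>2 + 3*Z\<^sup>2"
  shows "\<exists>X Y Z. n = X\<^sup>2 + Y\<^sup>2 + 3*Z\<^sup>2 \<and> odd X \<and> even (Y - Z)"
proof -
  have "(x + y + 3*z) mod 4 = (x mod 4 + y mod 4 + 3*(z mod 4)) mod 4" for x y z :: int
    by (simp only: mod_add_mult_mod mod_add_eq) (metis mod_add_left_eq mod_add_eq)
  then have "(X\<^sup>2 mod 4 + Y\<^sup>2 mod 4 + 3*(Z\<^sup>2 mod 4)) mod 4 = 1" using assms by simp
  then have "(odd X \<and> even (Y - Z)) \<or> (odd Y \<and> even (X - Z))"
    unfolding square_mod_4 by (cases "odd X"; cases "odd Y"; cases "odd Z") auto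
  then show ?thesis
  proof
    assume "odd Y \<and> even (X - Z)"
    moreover have "n = Y\<^sup>2 + X\<^sup>2 + 3*Z\<^sup>2" using assms by simp
    ultimately show ?thesis by blast
  qed (use assms in blast)
qed

text \<open>If 3 does not divide \<open>B\<close>, \<open>6*A - B\<^sup>2\<close> is automatically 2
  modulo 3. Otherwise it equals \<open>9*(2*A' - B'\<^sup>2)\<close>, and the residue is demanded of
  the cofactor; oddness supplies the residue 1 modulo 4.\<close>

definition admissible_pair :: "int \<Rightarrow> int \<Rightarrow> bool" where
  "admissible_pair A B \<longleftrightarrow> odd A \<and> odd B \<and>
     (\<not> 3 dvd B \<or> (\<exists>A' B'. A = 3*A' \<and> B = 3*B' \<and> (2*A' - B'\<^sup>2) mod 3 = 2))"

text \<open>The shift by \<open>k\<close> keeps \<open>a*A + b*B\<close>. In the worst case, 3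
  dividing \<open>a\<close> and \<open>B\<close>, three conditions are met by successive digits in
  \<open>k = k1 + 3*j + 9*i\<close>, at most 2 + 6 + 9 = 17.\<close>

lemma exists_admissible_pair:
  fixes a b A B :: int
  assumes ab: "odd a" "odd b" "coprime a b" and AB: "even (A - B)"
  shows "\<exists>k. 0 \<le> k \<and> k < 18 \<and> admissible_pair (A - b*k) (B + a*k)"
proof -
  have par: "odd (A - b*k) \<longleftrightarrow> odd (B + a*k)" for k using ab AB by auto
  show ?thesis
  proof (cases "3 dvd a")
    case False
    \<comment> \<open>\<open>a\<close> is its own inverse modulo 6, so this \<open>k\<close> makes
      \<open>B + a*k\<close> congruent to 1 modulo 6.\<close>
    define k where "k = (a*(1 - B)) mod 6"
    have k: "0 \<le> k" "k < 6" unfolding k_def by auto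
    have "a mod 6 = 1 \<or> a mod 6 = 5" using False ab(1) by presburger
    moreover have "a*a mod 6 = (a mod 6)*(a mod 6) mod 6" by (simp add: mod_mult_eq)
    ultimately have a2: "a*a mod 6 = 1" by auto
    have "(B + a*k) mod 6 = (B + a*(a*(1 - B))) mod 6" unfolding k_def by (rule mod_add_mult_mod)
    also have "a*(a*(1 - B)) = (1 - B)*(a*a)" by simp
    also have "(B + (1 - B)*(a*a)) mod 6 = (B + (1 - B)*(a*a mod 6)) mod 6" by (rule mod_add_mult_mod[symmetric])
    finally have *: "(B + a*k) mod 6 = 1" unfolding a2 by simp
    moreover have "odd m \<and> \<not> 3 dvd m" if "m mod 6 = 1" for m :: int using that by presburger
    ultimately have "odd (B + a*k)" "\<not> 3 dvd B + a*k" by blast+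
    then have "admissible_pair (A - b*k) (B + a*k)" using par unfolding admissible_pair_def by blast
    then show ?thesis using k by (intro exI[of _ k]) auto
  next
    case True
    then obtain a' where a': "a = 3*a'" by blast
    have "\<not> 3 dvd b"
    proof
      assume "3 dvd b"
      then have "3 dvd gcd a b" using True by simp
      then show False using ab(3) by simp
    qed
    show ?thesis
    proof (cases "3 dvd B")
      case False
      define k where "k = (if odd B then 0 else (1::int))"
      have "odd (B + a*k)" "0 \<le> k" "k < 18" using ab(1) unfolding k_def by auto
      moreover have "\<not> 3 dvd B + a*k" using False a' by (simp add: dvd_add_left_iff)
      ultimately show ?thesis using par unfolding admissible_pair_def by (intro exI[of _ k]) blast
    next
      case 3: True
      then obtain B0 where B0: "B = 3*B0" by blast
      have b2: "b*b mod 3 = 1" using square_mod_3[of b] \<open>\<not> 3 dvd b\<close> by (simp add: power2_eq_square)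
      \<comment> \<open>\<open>b\<close> is its own inverse modulo 3, so this digit makes the first
        component divisible by 3.\<close>
      define k1 where "k1 = (b*A) mod 3"
      have k1: "0 \<le> k1" "k1 \<le> 2" unfolding k1_def by (simp, presburger)
      have "(A + (-b)*k1) mod 3 = (A + (-b)*(b*A)) mod 3" unfolding k1_def by (rule mod_add_mult_mod)
      also have "(-b)*(b*A) = (-A)*(b*b)" by simp
      also have "(A + (-A)*(b*b)) mod 3 = (A + (-A)*(b*b mod 3)) mod 3" by (rule mod_add_mult_mod[symmetric])
      finally have "3 dvd A - b*k1" unfolding b2 by (simp add: dvd_eq_mod_eq_0)
      then obtain A1 where A1: "A - b*k1 = 3*A1" by blast
      define B1 where "B1 = B0 + a'*k1"
      \<comment> \<open>Since 3 divides \<open>a\<close>, this digit leaves the second cofactor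
        unchanged modulo 3 and moves only the first, by \<open>-b*j\<close>; \<open>j\<close> solves
        the resulting linear congruence.\<close>
      define j where "j = (b*(A1 - 1 + B1\<^sup>2)) mod 3"
      have j: "0 \<le> j" "j \<le> 2" unfolding j_def by (simp, presburger)
      have good: "(2*(A1 - b*j - 3*b*i) - (B1 + a*j + 3*a*i)\<^sup>2) mod 3 = 2" for i
      proof -
        have "(B1 + a*j + 3*a*i) mod 3 = B1 mod 3"
          using a' by (metis mod_mult_self2 mult.assoc mult.left_commute)
        then have "(B1 + a*j + 3*a*i)\<^sup>2 mod 3 = B1\<^sup>2 mod 3" by (metis power_mod)
        then have "(2*(A1 - b*j - 3*b*i) - (B1 + a*j + 3*a*i)\<^sup>2) mod 3 = (2*(A1 - b*j - 3*b*i) - B1\<^sup>2) mod 3"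
          by (metis mod_diff_right_eq)
        also have "\<dots> = (2*A1 - 2*(b*j) - B1\<^sup>2) mod 3"
        proof -
          have "2*(A1 - b*j - 3*b*i) - B1\<^sup>2 = (2*A1 - 2*(b*j) - B1\<^sup>2) + 3*(-2*b*i)" by (simp add: algebra_simps)
          then show ?thesis by (metis mod_mult_self2)
        qed
        also have "2*A1 - 2*(b*j) - B1\<^sup>2 = (2*A1 - B1\<^sup>2) + (-2*b)*j" by simp
        also have "\<dots> mod 3 = ((2*A1 - B1\<^sup>2) + (-2*b)*(b*(A1 - 1 + B1\<^sup>2))) mod 3"
          unfolding j_def by (rule mod_add_mult_mod)
        also have "(-2*b)*(b*(A1 - 1 + B1\<^sup>2)) = (-2*(A1 - 1 + B1\<^sup>2))*(b*b)" by (simp add: algebra_simps)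
        also have "((2*A1 - B1\<^sup>2) + \<dots>) mod 3 = ((2*A1 - B1\<^sup>2) + (-2*(A1 - 1 + B1\<^sup>2))*(b*b mod 3)) mod 3"
          by (rule mod_add_mult_mod[symmetric])
        also have "\<dots> = (2 + 3*(-(B1\<^sup>2))) mod 3" unfolding b2 by (simp add: algebra_simps)
        finally show ?thesis by (simp only: mod_mult_self2) simp
      qed
      \<comment> \<open>\<open>9*a\<close> is odd, so the last digit corrects the parity without
        disturbing the residues modulo 3.\<close>
      define i :: int where "i = (if odd (B + a*(k1 + 3*j)) then 0 else 1)"
      define k where "k = k1 + 3*j + 9*i"
      have k: "0 \<le> k" "k < 18" using k1 j unfolding k_def i_def by auto
      have odd: "odd (B + a*k)" using ab(1) unfolding k_def i_def by auto
      have "A - b*k = 3*(A1 - b*j - 3*b*i)" using A1 unfolding k_def by (simp add: algebra_simps)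
      moreover have "B + a*k = 3*(B1 + a*j + 3*a*i)" using B0 a' unfolding k_def B1_def by (simp add: algebra_simps)
      ultimately have "admissible_pair (A - b*k) (B + a*k)"
        using good[of i] odd par unfolding admissible_pair_def by blast
      then show ?thesis using k by blast
    qed
  qed
qed

text \<open>With \<open>p, t\<close> the two square roots in the conclusion and \<open>c = 36a\<^sup>2 - 2a + b\<close>,
  \<open>5p\<^sup>2 - 6t\<^sup>2 = 30(b - 2a)\<^sup>2\<close>; the hypothesis on \<open>n\<close> says exactly that \<open>p > 6c + 12ar\<close>, \<open>r\<close> being the
  square root in it, and for such \<open>p\<close> this is equivalent to \<open>t < p - c\<close>.\<close>

lemma root_gap:
  fixes a b n :: real
  assumes a: "a \<ge> 1" and b: "b > -a"
    and n: "n / 3 > 66 * a\<^sup>2 * (9*a - 1) + a + (33*a - 1)*b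
           + (2*a*(18*a - 1) + b) * sqrt (15 * (2*a*(9*a - 1) + b))"
  shows "n > a"
    "sqrt (48*a*n + 36*b\<^sup>2) - sqrt (40*a*n + (2*a + 5*b)\<^sup>2 - 24*a\<^sup>2) > 36*a\<^sup>2 - 2*a + b"
proof -
  define c r where "c = 36*a\<^sup>2 - 2*a + b" and "r = sqrt (15 * (18*a\<^sup>2 - 2*a + b))"
  have a2: "a\<^sup>2 \<ge> a" using a by (simp add: power2_eq_square)
  then have c: "c > 0" using a b unfolding c_def by linarith
  have pos: "18*a\<^sup>2 - 2*a + b > 0" using a b a2 by linarith
  then have r: "r \<ge> 0" "r\<^sup>2 = 15 * (18*a\<^sup>2 - 2*a + b)" unfolding r_def by auto
  have n': "n / 3 > 594*a^3 - 66*a\<^sup>2 + a + 33*a*b - b + c*r"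
    using n unfolding c_def r_def by (simp add: algebra_simps power2_eq_square power3_eq_cube)
  have "a^3 \<ge> a\<^sup>2" using a by (simp add: power_increasing)
  moreover have "(33*a - 1)*(b + a) \<ge> 0" using a b by simp
  then have "33*a*b - b \<ge> - 33*a\<^sup>2 + a" by (simp add: algebra_simps power2_eq_square)
  moreover have "c*r \<ge> 0" using c r by simp
  ultimately show na: "n > a" using n' a a2 by linarith
  define p t where "p = sqrt (48*a*n + 36*b\<^sup>2)" and "t = sqrt (40*a*n + (2*a + 5*b)\<^sup>2 - 24*a\<^sup>2)"
  have an: "a*n \<ge> a\<^sup>2" using na a by (simp add: power2_eq_square)
  then have "48*a*n + 36*b\<^sup>2 \<ge> 0" using zero_le_power2[of a] zero_le_power2[of b] by linarith
  then have p: "p \<ge> 0" "p\<^sup>2 = 48*a*n + 36*b\<^sup>2" unfolding p_def by auto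
  have "40*a*n + (2*a + 5*b)\<^sup>2 - 24*a\<^sup>2 \<ge> 0"
    using an zero_le_power2[of "2*a + 5*b"] zero_le_power2[of a] by linarith
  then have t: "t\<^sup>2 = 40*a*n + (2*a + 5*b)\<^sup>2 - 24*a\<^sup>2" unfolding t_def by auto
  have "(6*c + 12*a*r)\<^sup>2 = 36*c\<^sup>2 + 144*a*(c*r) + 144*a\<^sup>2*r\<^sup>2"
    by (simp add: algebra_simps power2_eq_square)
  also have "\<dots> = 144*a*(594*a^3 - 66*a\<^sup>2 + a + 33*a*b - b + c*r) + 36*b\<^sup>2"
    unfolding r c_def by (simp add: algebra_simps power2_eq_square power3_eq_cube)
  also have "\<dots> < 144*a*(n/3) + 36*b\<^sup>2" using n' a by simp
  also have "\<dots> = p\<^sup>2" unfolding p by simp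
  finally have pc: "6*c + 12*a*r < p" using p(1) by (rule power_less_imp_less_base)
  have "12*a*r \<ge> 0" using a r by simp
  then have "(12*a*r)\<^sup>2 < (p - 6*c)\<^sup>2" using pc by (intro power_strict_mono) auto
  \<comment> \<open>\<open>c\<^sup>2 - (b - 2*a)\<^sup>2\<close> factors as
    \<open>72*a\<^sup>2\<close> times \<open>18*a\<^sup>2 - 2*a + b\<close>, which explains the
    radicand of \<open>r\<close>: \<open>t < p - c\<close> squares to a comparison of
    \<open>(p - 6*c)\<^sup>2\<close> with \<open>(12*a*r)\<^sup>2\<close>.\<close>
  moreover have "(12*a*r)\<^sup>2 = 30*(c\<^sup>2 - (b - 2*a)\<^sup>2)"
    unfolding power_mult_distrib r c_def by (simp add: algebra_simps power2_eq_square)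
  moreover have "6*t\<^sup>2 = 5*p\<^sup>2 - 30*(b - 2*a)\<^sup>2"
    unfolding p t by (simp add: algebra_simps power2_eq_square)
  moreover have "6*(p - c)\<^sup>2 = 5*p\<^sup>2 + (p - 6*c)\<^sup>2 - 30*c\<^sup>2"
    by (simp add: algebra_simps power2_eq_square)
  ultimately have "t\<^sup>2 < (p - c)\<^sup>2" by (simp add: right_diff_distrib)
  moreover have "p - c \<ge> 0" using pc c \<open>12*a*r \<ge> 0\<close> by linarith
  ultimately have "t < p - c" by (rule power_less_imp_less_base)
  then show "sqrt (48*a*n + 36*b\<^sup>2) - sqrt (40*a*n + (2*a + 5*b)\<^sup>2 - 24*a\<^sup>2) > 36*a\<^sup>2 - 2*a + b"
    unfolding p_def t_def c_def by linarith
qed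

section \<open>From admissible pairs to the representation of \<open>n\<close>\<close>

lemma sign_choice:
  fixes X B :: int
  assumes "\<not> 3 dvd X" "\<not> 3 dvd B"
  shows "\<exists>X'. X'\<^sup>2 = X\<^sup>2 \<and> even (X' - X) \<and> 3 dvd X' + B"
proof (cases "3 dvd X + B")
  case False
  then have "3 dvd - X + B" using assms by presburger
  then show ?thesis by (intro exI[of _ "-X"]) simp
qed auto

lemma mod_12_eq_5:
  fixes m :: int
  assumes "m mod 4 = 1" "m mod 3 = 2"
  shows "m mod 12 = 5"
proof -
  have "4 dvd m - 5" "3 dvd m - 5" using assms by presburger+
  moreover have "coprime (4::int) 3" by (simp add: coprime_iff_gcd_eq_1 gcd_non_0_int)
  ultimately have "4 * 3 dvd m - 5" by (rule divides_mult)
  then show ?thesis by presburger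
qed

lemma admissible_pair_represented:
  fixes A B :: int
  assumes adm: "admissible_pair A B" and B: "B \<ge> 0" "B\<^sup>2 < 6*A" "5*A < B\<^sup>2 + 2*B + 6"
  shows "\<exists>w x y z :: nat. 3*(int w)\<^sup>2 + (int x)\<^sup>2 + (int y)\<^sup>2 + (int z)\<^sup>2 = A \<and>
    3*int w + int x + int y + int z = B"
proof -
  have odd: "odd A" "odd B" using adm unfolding admissible_pair_def by auto
  have six: "6 dvd X + B" if "odd X" "3 dvd X + B" for X
    using that odd(2) by presburger
  have B4: "B\<^sup>2 mod 4 = 1" using square_mod_4 odd(2) by simp
  show ?thesis
  proof (cases "3 dvd B")
    case False
    have "(6*A - B\<^sup>2) mod 4 = 1" using B4 odd(1) by presburger
    moreover have "(6*A - B\<^sup>2) mod 3 = 2" using square_mod_3[of B] False by presburger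
    ultimately have n: "(6*A - B\<^sup>2) mod 12 = 5" "(6*A - B\<^sup>2) mod 4 = 1" using mod_12_eq_5 by blast+
    obtain X Y Z where XYZ: "6*A - B\<^sup>2 = X\<^sup>2 + Y\<^sup>2 + 3*Z\<^sup>2" "odd X" "even (Y - Z)"
      using sum_113[OF _ n(1)] sum_113_parity[OF n(2)] B(2) by (metis diff_gt_0_iff_gt)
    have "(X\<^sup>2 + Y\<^sup>2 + 3*Z\<^sup>2) mod 3 = 2" using \<open>(6*A - B\<^sup>2) mod 3 = 2\<close> unfolding XYZ(1) .
    \<comment> \<open>A residue 2 forces \<open>X\<close> and \<open>Y\<close> to be prime to 3, so
      changing signs makes both congruent to \<open>-B\<close> modulo 3 and keeps all
      parities.\<close>
    then have "(X\<^sup>2 mod 3 + Y\<^sup>2 mod 3) mod 3 = 2" by presburger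
    then have "\<not> 3 dvd X" "\<not> 3 dvd Y" unfolding square_mod_3 by (auto split: if_splits)
    then obtain X' Y' where X': "X'\<^sup>2 = X\<^sup>2" "even (X' - X)" "3 dvd X' + B"
      and Y': "Y'\<^sup>2 = Y\<^sup>2" "even (Y' - Y)" "3 dvd Y' + B" using sign_choice False by metis
    show ?thesis
    proof (rule cauchy_lemma_3111)
      show "6*A - B\<^sup>2 = X'\<^sup>2 + Y'\<^sup>2 + 3*Z\<^sup>2" using XYZ(1) X'(1) Y'(1) by simp
      have "odd X'" using X'(2) XYZ(2) by presburger
      then show "6 dvd X' + B" using X'(3) by (rule six)
      show "even (Y' - Z)" using Y'(2) XYZ(3) by presburger
    qed (use Y' B in auto)
  next
    case True
    then obtain A' B' where A': "A = 3*A'" "B = 3*B'" "(2*A' - B'\<^sup>2) mod 3 = 2"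
      using adm unfolding admissible_pair_def by blast
    have "odd A'" "odd B'" using odd A' by auto
    then have "(2*A' - B'\<^sup>2) mod 4 = 1" using square_mod_4[of B'] by presburger
    then have n: "(2*A' - B'\<^sup>2) mod 12 = 5" "(2*A' - B'\<^sup>2) mod 4 = 1" using A'(3) mod_12_eq_5 by blast+
    have "2*A' - B'\<^sup>2 > 0" using B(2) unfolding A' by (simp add: power_mult_distrib)
    then obtain X Y Z where XYZ: "2*A' - B'\<^sup>2 = X\<^sup>2 + Y\<^sup>2 + 3*Z\<^sup>2" "odd X" "even (Y - Z)"
      using sum_113[OF _ n(1)] sum_113_parity[OF n(2)] by metis
    show ?thesis
    proof (rule cauchy_lemma_3111)
      \<comment> \<open>Multiplying by 9 makes the required divisibilities by 3 automatic, as 3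
        divides \<open>B\<close>.\<close>
      show "6*A - B\<^sup>2 = (3*X)\<^sup>2 + (3*Y)\<^sup>2 + 3*(3*Z)\<^sup>2"
        using XYZ(1) unfolding A' by (simp add: power_mult_distrib)
      show "6 dvd 3*X + B" by (rule six) (use XYZ(2) A'(2) in auto)
      show "even (3*Y - 3*Z)" using XYZ(3) by presburger
    qed (use A' B in auto)
  qed
qed

lemma exists_residue_above:
  fixes a u :: int and L :: real
  assumes "a > 0"
  shows "\<exists>B. [B = u] (mod a) \<and> L < B \<and> B \<le> L + a"
proof -
  define m where "m = \<lfloor>L\<rfloor> + 1"
  define B where "B = m + (u - m) mod a"
  have "[B = u] (mod a)" unfolding B_def cong_def by (simp add: mod_add_right_eq)
  moreover have "0 \<le> (u - m) mod a" "(u - m) mod a \<le> a - 1" using assms by (auto simp: pos_mod_bound)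
  then have "m \<le> B" "B \<le> m + a - 1" unfolding B_def by auto
  moreover have "L < m" "m \<le> L + 1" unfolding m_def by linarith+
  ultimately show ?thesis by (intro exI[of _ B]) linarith
qed

theorem corollary9:
  fixes a b n :: int
  assumes "odd a" and "odd b" and "a > 0" and "b > - a" and "gcd a b = 1"
    and "real_of_int n / 3 >
           66 * (real_of_int a)\<^sup>2 * (9 * real_of_int a - 1) + real_of_int a
           + (33 * real_of_int a - 1) * real_of_int b
           + (2 * real_of_int a * (18 * real_of_int a - 1) + real_of_int b)
             * sqrt (15 * (2 * real_of_int a * (9 * real_of_int a - 1) + real_of_int b))"
  shows "\<exists>w x y z :: nat.
           real_of_int n =
             3 * (real w * (real_of_int a * real w + real_of_int b) / 2)
             + real x * (real_of_int a * real x + real_of_int b) / 2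
             + real y * (real_of_int a * real y + real_of_int b) / 2
             + real z * (real_of_int a * real z + real_of_int b) / 2"
proof -
  define p t where "p = sqrt (48*real_of_int a*n + 36*(real_of_int b)\<^sup>2)"
    and "t = sqrt (40*real_of_int a*n + (2*real_of_int a + 5*b)\<^sup>2 - 24*(real_of_int a)\<^sup>2)"
  have a1: "real_of_int a \<ge> 1" and ba: "real_of_int b > - real_of_int a" using assms(3,4) by linarith+
  have na: "real_of_int n > a" and gap: "p - t > 36*(real_of_int a)\<^sup>2 - 2*a + b"
    using root_gap[OF a1 ba assms(6)] unfolding p_def t_def by auto
  have an: "real_of_int a*n \<ge> (real_of_int a)\<^sup>2" using na a1 by (simp add: power2_eq_square)
  have "48*real_of_int a*n + 36*(real_of_int b)\<^sup>2 \<ge> 0"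
    using an zero_le_power2[of "real_of_int a"] zero_le_power2[of "real_of_int b"] by linarith
  then have p: "p \<ge> 0" "p\<^sup>2 = 48*real_of_int a*n + 36*(real_of_int b)\<^sup>2" unfolding p_def by auto
  define T where "T = 40*real_of_int a*n + (2*real_of_int a + 5*b)\<^sup>2 - 24*(real_of_int a)\<^sup>2"
  have T: "T \<ge> (2*real_of_int a + 5*b)\<^sup>2"
    using an zero_le_power2[of "real_of_int a"] unfolding T_def by linarith
  then have "T \<ge> 0" using zero_le_power2 order_trans by blast
  then have t: "t \<ge> 0" "t\<^sup>2 = T" unfolding t_def T_def by auto
  have t5: "t \<ge> 2*real_of_int a + 5*b" using T[folded t(2)] t(1) by (rule power2_le_imp_le)
  \<comment> \<open>With \<open>A = (2*n - b*B)/a\<close>, the condition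
    \<open>5*A < B\<^sup>2 + 2*B + 6\<close> is quadratic in \<open>B\<close> and its larger root is
    \<open>L\<close>. Likewise \<open>B\<^sup>2 < 6*A\<close> has the upper root
    \<open>(p - 6*b)/(2*a)\<close>.\<close>
  define L where "L = (t - 2*real_of_int a - 5*b) / (2*a)"
  have L: "L \<ge> 0" using t5 a1 unfolding L_def by simp
  have copr: "coprime b a" using assms(5) by (simp add: coprime_iff_gcd_eq_1 gcd.commute)
  then obtain b' where b': "[b * b' = 1] (mod a)" using cong_solve_coprime_int by blast
  \<comment> \<open>The residue class modulo \<open>a\<close> in which \<open>2*n - b*B\<close> is
    divisible by \<open>a\<close>. At most \<open>17*a\<close> is added to \<open>B0\<close> later,
    so \<open>B\<close> stays within \<open>18*a\<close> of \<open>L\<close>.\<close>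
  obtain B0 where B0: "[B0 = b' * (2*n)] (mod a)" "L < B0" "B0 \<le> L + a"
    using exists_residue_above[OF assms(3)] by blast
  have "[b * B0 = b * (b' * (2*n))] (mod a)" using B0(1) by (intro cong_mult) auto
  also have "b * (b' * (2*n)) = (b * b') * (2*n)" by simp
  also have "[(b * b') * (2*n) = 1 * (2*n)] (mod a)" using b' by (intro cong_mult) auto
  finally have "a dvd 2*n - b*B0" by (simp add: cong_iff_dvd_diff dvd_diff_commute)
  then obtain A0 where A0: "2*n - b*B0 = a*A0" by blast
  have "even (a*A0 + b*B0)" using A0 by (metis add.commute add_diff_cancel_left' diff_add_cancel dvd_triv_left)
  then have "even (A0 - B0)" using assms(1,2) by auto
  from exists_admissible_pair[OF assms(1,2) _ this] copr obtain k where k: "0 \<le> k" "k < 18"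
    and adm: "admissible_pair (A0 - b*k) (B0 + a*k)" by (auto simp: coprime_commute)
  define A B where "A = A0 - b*k" and "B = B0 + a*k"
  have AB: "2*n = a*A + b*B" using A0 unfolding A_def B_def by (simp add: algebra_simps)
  have "real_of_int a*k \<ge> 0" using k(1) a1 by simp
  then have LB: "L < B" using B0(2) unfolding B_def by simp
  have "real_of_int a*k \<le> real_of_int a*17" using k(2) a1 by (intro mult_left_mono) auto
  then have "B \<le> L + 18*a" using B0(3) unfolding B_def by simp
  then have "2*real_of_int a*B \<le> 2*real_of_int a*(L + 18*a)" using a1 by (intro mult_left_mono) auto
  also have "\<dots> = t - 2*a - 5*b + 36*(real_of_int a)\<^sup>2"
    using a1 unfolding L_def by (simp add: field_simps power2_eq_square)
  also have "\<dots> < p - 6*b" using gap by linarith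
  finally have upper: "2*real_of_int a*B + 6*b < p" by simp
  have lower: "t < 2*real_of_int a*B + 2*a + 5*b"
    using LB a1 unfolding L_def by (simp add: field_simps)
  have B: "B \<ge> 0" using LB L by linarith
  have AB': "2*real_of_int n = real_of_int a*A + real_of_int b*B" using AB by (metis of_int_add of_int_mult of_int_numeral)
  have "t\<^sup>2 < (2*real_of_int a*B + 2*a + 5*b)\<^sup>2" using lower t(1) by (rule power_strict_mono) simp
  then have "4*real_of_int a*(5*(2*real_of_int n)) < 4*real_of_int a*(a*(real_of_int B)\<^sup>2 + (2*a + 5*b)*B + 6*a)"
    unfolding t(2) T_def by (simp add: algebra_simps power2_eq_square)
  then have "5*(2*real_of_int n) < a*(real_of_int B)\<^sup>2 + (2*a + 5*b)*B + 6*a" using a1 by simp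
  then have "real_of_int a*(5*A) < real_of_int a*((real_of_int B)\<^sup>2 + 2*B + 6)"
    unfolding AB' by (simp add: algebra_simps)
  then have "5*real_of_int A < (real_of_int B)\<^sup>2 + 2*B + 6" using a1 by simp
  then have low: "5*A < B\<^sup>2 + 2*B + 6" by (metis (mono_tags) of_int_add of_int_less_iff of_int_mult of_int_numeral of_int_power)
  \<comment> \<open>As \<open>b\<close> may be negative, \<open>2*a*B + 6*b\<close> also needs a
    lower bound before the upper inequality can be squared.\<close>
  have "- p < 6*real_of_int b"
  proof -
    have "real_of_int a*n > 0" using a1 na by simp
    then have "(- 6*real_of_int b)\<^sup>2 < p\<^sup>2" unfolding p(2) by (simp add: power_mult_distrib)
    then have "- 6*real_of_int b < p" using p(1) by (rule power2_less_imp_less)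
    then show ?thesis by linarith
  qed
  moreover have "2*real_of_int a*B \<ge> 0" using a1 B by simp
  ultimately have "\<bar>2*real_of_int a*B + 6*b\<bar> < \<bar>p\<bar>" using upper by linarith
  then have "(2*real_of_int a*B + 6*b)\<^sup>2 < p\<^sup>2" using power_strict_mono[of "\<bar>2*real_of_int a*B + 6*b\<bar>" "\<bar>p\<bar>" 2] by simp
  then have "4*real_of_int a*(a*(real_of_int B)\<^sup>2 + 6*b*B) < 4*real_of_int a*(6*(2*real_of_int n))"
    unfolding p(2) by (simp add: algebra_simps power2_eq_square)
  then have "a*(real_of_int B)\<^sup>2 + 6*b*B < 6*(2*real_of_int n)" using a1 by simp
  then have "real_of_int a*(real_of_int B)\<^sup>2 < real_of_int a*(6*A)"
    unfolding AB' by (simp add: algebra_simps)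
  then have "(real_of_int B)\<^sup>2 < 6*real_of_int A" using a1 by simp
  then have up: "B\<^sup>2 < 6*A" by (metis (mono_tags) of_int_less_iff of_int_mult of_int_numeral of_int_power)
  obtain w x y z :: nat where *: "3*(int w)\<^sup>2 + (int x)\<^sup>2 + (int y)\<^sup>2 + (int z)\<^sup>2 = A"
    "3*int w + int x + int y + int z = B"
    using admissible_pair_represented[OF _ B up low] adm unfolding A_def B_def by blast
  have "2*n = a*(3*(int w)\<^sup>2 + (int x)\<^sup>2 + (int y)\<^sup>2 + (int z)\<^sup>2) + b*(3*int w + int x + int y + int z)"
    unfolding * by (rule AB)
  then have "real_of_int (2*n) = real_of_int (a*(3*(int w)\<^sup>2 + (int x)\<^sup>2 + (int y)\<^sup>2 + (int z)\<^sup>2) + b*(3*int w + int x + int y + int z))"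
    by (rule arg_cong)
  then have "real_of_int n =
             3 * (real w * (real_of_int a * real w + real_of_int b) / 2)
             + real x * (real_of_int a * real x + real_of_int b) / 2
             + real y * (real_of_int a * real y + real_of_int b) / 2
             + real z * (real_of_int a * real z + real_of_int b) / 2"
    by (simp add: field_simps power2_eq_square)
  then show ?thesis by blast
qed

end
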